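(* In the AMLI-cycle setting described in the context, assume that the two-grid method converges uniformly with convergence rate $\delta_{TG}$. Let $0<a<2$, let $\widetilde p_2(\widetilde x)=(1-a\widetilde x)(1-2\widetilde x)$, and let $\widetilde\nu\in(0,1)$ be such that $\widetilde p_2(\widetilde\nu)\ge0$, $\widetilde p_2$ is decreasing on $(0,\widetilde\nu]$, and $\widetilde p_2(\widetilde\nu)\ge\max_{\widetilde x\in[\widetilde\nu,1]}\widetilde p_2(\widetilde x)$. Set $$L=\begin{cases}2-a,&0<a<\frac23,\\[2pt] \dfrac{(2+a)^2}{8a},&\frac23\le a<2,\end{cases}\qquad p_2(x)=\widetilde p_2\left(\frac xL\right).$$ Then the AMLI operators $B_\ell$ defined with the polynomial $p=p_2$ satisfy $$\kappa(B_\ell A_\ell)\le\frac L\mu\quad\text{for all levels }\ell,$$ provided there exists $0<\mu\le\bar\mu:=\min\{L\widetilde\nu,\,1-\delta_{TG}\}$ such that $$\mu\le(1-\delta_{TG})\left[1-p_2(\mu)\right].$$ Moreover, a sufficient condition for the existence of such a $\mu$ is $$\delta_{TG}<\begin{cases}1-\dfrac{2-a}{2+a},&0<a<\frac23,\\[6pt] 1-\dfrac{2+a}{8a},&\frac23\le a<2.\end{cases}$$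
   Context: AMLI-cycle setting. SPD means symmetric positive definite. Let $J\ge 2$ be the number of levels. For $\ell=1,\dots,J$ let $A_\ell\in\mathbb{R}^{n_\ell\times n_\ell}$ be SPD, and for $\ell=1,\dots,J-1$ let $P_\ell\in\mathbb{R}^{n_\ell\times n_{\ell+1}}$ (prolongation) be such that $A_{\ell+1}=P_\ell^TA_\ell P_\ell$. For $\ell=1,\dots,J-1$ let $M_\ell\in\mathbb{R}^{n_\ell\times n_\ell}$ be a nonsingular matrix (smoother) which is nonexpansive: $\|I-M_\ell A_\ell\|_{A_\ell}\le 1$, where $\|\cdot\|_{A_\ell}$ is the operator norm induced by the inner product $(u,v)_{A_\ell}=(A_\ell u,v)$. Put $\overline{M}_\ell:=M_\ell^T(M_\ell^{-1}+M_\ell^{-T}-A_\ell)M_\ell=M_\ell+M_\ell^T-M_\ell^TA_\ell M_\ell$. Given a polynomial $p$ with $p(0)=1$, the AMLI operators are defined recursively from the coarsest level by $B_J=\widehat B_J=A_J^{-1}$, and $$B_\ell=\overline M_\ell+(I-M_\ell^TA_\ell)P_\ell\widehat B_{\ell+1}P_\ell^T(I-A_\ell M_\ell),\quad \ell=J-1,\dots,1,$$ $$\widehat B_\ell=(I-p(B_\ell A_\ell))A_\ell^{-1},\quad \ell=2,\dots,J-1.$$ The two-grid operator on level $\ell\le J-1$ is $B^{TG}_\ell=\overline M_\ell+(I-M_\ell^TA_\ell)P_\ell A_{\ell+1}^{-1}P_\ell^T(I-A_\ell M_\ell)$. "The two-grid method converges uniformly with convergence rate $\delta_{TG}$" means that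 $\delta_{TG}\in[0,1)$ and, for all $\ell=1,\dots,J-1$, $\lambda_{\min}(B_\ell^{TG}A_\ell)\ge 1-\delta_{TG}$ and $\lambda_{\max}(B_\ell^{TG}A_\ell)\le 1$. $\kappa(B_\ell A_\ell)=\lambda_{\max}(B_\ell A_\ell)/\lambda_{\min}(B_\ell A_\ell)$; a bound $\kappa(B_\ell A_\ell)\le C$ means that all eigenvalues of $B_\ell A_\ell$ are positive and $\lambda_{\max}\le C\lambda_{\min}$. $\widetilde p_2$ is the momentum-accelerated (MA) polynomial of degree 2, from the recurrence $\widetilde p_{k+1}(\widetilde x)=2(1-a\widetilde x)\widetilde p_k(\widetilde x)-(1-a\widetilde x)\widetilde p_{k-1}(\widetilde x)$, $\widetilde p_0=1$, $\widetilde p_1=1-\widetilde x$. *)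

theory Defs
  imports
    "Jordan_Normal_Form.Gauss_Jordan_Elimination"
    "Jordan_Normal_Form.Spectral_Radius"
begin

definition spd_mat :: "nat \<Rightarrow> real mat \<Rightarrow> bool" where
  "spd_mat n A \<longleftrightarrow> A \<in> carrier_mat n n \<and> transpose_mat A = A \<and>
     (\<forall>v \<in> carrier_vec n. v \<noteq> 0\<^sub>v n \<longrightarrow> scalar_prod (A *\<^sub>v v) v > 0)"

text \<open>Only meaningful for invertible matrices.\<close>

definition minv :: "real mat \<Rightarrow> real mat" where
  "minv A = the (mat_inverse A)"

definition energy_norm :: "real mat \<Rightarrow> real vec \<Rightarrow> real" where
  "energy_norm A v = sqrt (scalar_prod (A *\<^sub>v v) v)"

definition energy_opnorm :: "real mat \<Rightarrow> real mat \<Rightarrow> real" where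
  "energy_opnorm A T =
     (SUP v \<in> carrier_vec (dim_row A) - {0\<^sub>v (dim_row A)}.
        energy_norm A (T *\<^sub>v v) / energy_norm A v)"

text \<open>
  Smallest and largest real eigenvalue. For square matrices of positive dimension all of
  whose complex eigenvalues are real, such as the products of two symmetric matrices with
  a positive definite factor considered below, the real spectrum is finite, nonempty and
  equal to the complex one.
\<close>

definition lambda_min :: "real mat \<Rightarrow> real" where
  "lambda_min X = Min (spectrum X)"

definition lambda_max :: "real mat \<Rightarrow> real" where
  "lambda_max X = Max (spectrum X)"

text \<open>
  The condition number bound \<open>lambda_max X / lambda_min X \<le> C\<close>. All complex eigenvalues
  are required to be positive real numbers.
\<close>

definition kappa_le :: "real mat \<Rightarrow> real \<Rightarrow> bool" where
  "kappa_le X C \<longleftrightarrow>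
     (\<forall>z. eigenvalue (map_mat complex_of_real X) z \<longrightarrow> z \<in> \<real> \<and> Re z > 0) \<and>
     lambda_max X \<le> C * lambda_min X"

definition poly_mat :: "real poly \<Rightarrow> real mat \<Rightarrow> real mat" where
  "poly_mat p X = mat (dim_row X) (dim_row X)
     (\<lambda>(i, j). \<Sum>k\<le>degree p. coeff p k * (X ^\<^sub>m k) $$ (i, j))"

definition sym_smoother :: "real mat \<Rightarrow> real mat \<Rightarrow> real mat" where
  "sym_smoother A M =
     transpose_mat M * (minv M + transpose_mat (minv M) - A) * M"

text \<open>
  One step on a level with matrix \<open>A\<close>, smoother \<open>M\<close> and prolongation \<open>P\<close>, where \<open>C\<close>
  replaces the inverse of the matrix on the next coarser level.
\<close>

definition cycle_op :: "real mat \<Rightarrow> real mat \<Rightarrow> real mat \<Rightarrow> real mat \<Rightarrow> real mat" where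
  "cycle_op A M P C = sym_smoother A M +
     (1\<^sub>m (dim_row A) - transpose_mat M * A) * P * C * transpose_mat P *
     (1\<^sub>m (dim_row A) - A * M)"

definition two_grid_op ::
    "(nat \<Rightarrow> real mat) \<Rightarrow> (nat \<Rightarrow> real mat) \<Rightarrow> (nat \<Rightarrow> real mat) \<Rightarrow> nat \<Rightarrow> real mat" where
  "two_grid_op A M P l = cycle_op (A l) (M l) (P l) (minv (A (Suc l)))"

definition two_grid_converges ::
    "nat \<Rightarrow> (nat \<Rightarrow> real mat) \<Rightarrow> (nat \<Rightarrow> real mat) \<Rightarrow> (nat \<Rightarrow> real mat) \<Rightarrow> real \<Rightarrow> bool" where
  "two_grid_converges J A M P \<delta> \<longleftrightarrow> 0 \<le> \<delta> \<and> \<delta> < 1 \<and>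
     (\<forall>l \<in> {1..<J}. lambda_min (two_grid_op A M P l * A l) \<ge> 1 - \<delta> \<and>
                   lambda_max (two_grid_op A M P l * A l) \<le> 1)"

text \<open>
  Level 1 is the finest and level \<open>J\<close> the coarsest; values for levels above \<open>J\<close> are
  irrelevant. \<open>amli_op\<close> is $B_\ell$ and \<open>amli_op_hat\<close> is $\widehat B_\ell$.
\<close>

definition amli_correction :: "real poly \<Rightarrow> real mat \<Rightarrow> real mat \<Rightarrow> real mat" where
  "amli_correction p A B = (1\<^sub>m (dim_row A) - poly_mat p (B * A)) * minv A"

function amli_op ::
    "real poly \<Rightarrow> nat \<Rightarrow> (nat \<Rightarrow> real mat) \<Rightarrow> (nat \<Rightarrow> real mat) \<Rightarrow> (nat \<Rightarrow> real mat)
       \<Rightarrow> nat \<Rightarrow> real mat"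
  and amli_op_hat ::
    "real poly \<Rightarrow> nat \<Rightarrow> (nat \<Rightarrow> real mat) \<Rightarrow> (nat \<Rightarrow> real mat) \<Rightarrow> (nat \<Rightarrow> real mat)
       \<Rightarrow> nat \<Rightarrow> real mat" where
  "amli_op p J A M P l =
     (if l \<ge> J then minv (A J)
      else cycle_op (A l) (M l) (P l) (amli_op_hat p J A M P (Suc l)))"
| "amli_op_hat p J A M P l =
     (if l \<ge> J then minv (A J)
      else amli_correction p (A l) (amli_op p J A M P l))"
  by pat_completeness auto
termination
  by (relation "measure (\<lambda>s. case s of
        Inl (p, J, A, M, P, l) \<Rightarrow> 2 * (J - l)
      | Inr (p, J, A, M, P, l) \<Rightarrow> 2 * (J - l) + 1)") auto

declare amli_op.simps [simp del] amli_op_hat.simps [simp del]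

fun ma_poly :: "real \<Rightarrow> nat \<Rightarrow> real poly" where
  "ma_poly a 0 = 1"
| "ma_poly a (Suc 0) = [:1, -1:]"
| "ma_poly a (Suc (Suc k)) =
     2 * [:1, -a:] * ma_poly a (Suc k) - [:1, -a:] * ma_poly a k"

lemma ma_poly_2: "ma_poly a 2 = [:1, -a:] * [:1, -2:]"
  by (simp add: eval_nat_numeral(2) numeral_poly one_pCons)

lemma poly_ma_poly_2: "poly (ma_poly a 2) x = (1 - a * x) * (1 - 2 * x)"
  by (simp add: ma_poly_2 algebra_simps)

text \<open>The maximum of \<open>1 - (1 - a * x) * (1 - 2 * x)\<close> over \<open>x \<in> [0, 1]\<close>.\<close>

definition ma_L :: "real \<Rightarrow> real" where
  "ma_L a = (if a < 2 / 3 then 2 - a else (2 + a)\<^sup>2 / (8 * a))"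

definition ma_poly2_scaled :: "real \<Rightarrow> real poly" where
  "ma_poly2_scaled a = pcompose (ma_poly a 2) [:0, 1 / ma_L a:]"

lemma poly_ma_poly2_scaled: "poly (ma_poly2_scaled a) x = poly (ma_poly a 2) (x / ma_L a)"
  by (simp add: ma_poly2_scaled_def poly_pcompose)

definition admissible_mu :: "real \<Rightarrow> real \<Rightarrow> real \<Rightarrow> real \<Rightarrow> bool" where
  "admissible_mu a \<nu> \<delta> \<mu> \<longleftrightarrow>
     0 < \<mu> \<and> \<mu> \<le> min (ma_L a * \<nu>) (1 - \<delta>) \<and>
     \<mu> \<le> (1 - \<delta>) * (1 - poly (ma_poly2_scaled a) \<mu>)"

end

theory Submission
  imports Defs "HOL-Analysis.Function_Topology"
begin

text \<open>
  Spectral bounds on $BA$, with $A$ SPD and $B$ symmetric, are inequalities between symmetric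
  matrices: the eigenvalues of $BA$ lie in $[\mu, L]$ exactly when $\mu A^{-1} \le B \le L A^{-1}$ in
  the Loewner order. In this form the bounds can be carried from the coarsest level to the finest
  one by induction, because $B_\ell$ is $\overline M_\ell + K^T \widehat B_{\ell+1} K$ with a
  matrix $K$ that does not depend on $\widehat B_{\ell+1}$, and the smoother is nonexpansive exactly
  when $\overline M_\ell \ge 0$. Hence $c A_{\ell+1}^{-1} \le \widehat B_{\ell+1} \le L A_{\ell+1}^{-1}$
  with $0 \le c \le 1 \le L$ gives $c B^{TG}_\ell \le B_\ell \le L B^{TG}_\ell$, and the two-grid
  bounds turn this into $(1 - \delta_{TG}) c A_\ell^{-1} \le B_\ell \le L A_\ell^{-1}$. The condition
  on $\mu$ says that $(1 - \delta_{TG}) c \ge \mu$ for $c = 1 - p_2(\mu)$, so that the induction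
  closes (\<open>cycle_op_bounds\<close>, \<open>amli_op_bounds\<close>).

  It remains to pass from $\mu A^{-1} \le B \le L A^{-1}$ to
  $c A^{-1} \le \widehat B \le L A^{-1}$ (\<open>ma_correction_maps_bounds\<close>). As $p_2$ is
  quadratic, say $1 - p_2(x) = \beta x - \gamma x^2$, one has $\widehat B = \beta B - \gamma BAB$
  and no functional calculus is needed. The function $1 - p_2$ is concave, so on $[\mu, L]$ it lies
  above its chord; for matrices this is the inequality $(B - \mu A^{-1}) A (L A^{-1} - B) \ge 0$
  (\<open>square_le_chord\<close>). The hypotheses on $\widetilde\nu$ imply $p_2(L) \le p_2(\mu)$, so the chord
  does not decrease and the smallest value is $c$. For the upper bound, $L - (1 - p_2(x))$ is a
  nonnegative multiple of $L - x$ plus a nonnegative multiple of a square.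

  The link between spectra and the Loewner order is that the extreme values of a Rayleigh quotient
  are attained, and attained at eigenvectors (\<open>rayleigh_min_attained\<close>). The same fact bounds the
  quotients in the supremum that defines the energy operator norm. That $BA$ has no complex
  eigenvalues but the real ones holds because it is self-adjoint in the inner product of $A$.

  Finally $1 - p_2(\mu) = ((a + 2) / L) \mu + O(\mu^2)$, so all small $\mu > 0$ satisfy the condition
  as soon as $(1 - \delta_{TG}) (a + 2) / L > 1$, which is the sufficient condition on $\delta_{TG}$.
\<close>

section \<open>Symmetric matrices and the Loewner order\<close>

definition sym_mat :: "nat \<Rightarrow> real mat \<Rightarrow> bool" where
  "sym_mat n G \<longleftrightarrow> G \<in> carrier_mat n n \<and> transpose_mat G = G"

definition loewner_le :: "nat \<Rightarrow> real mat \<Rightarrow> real mat \<Rightarrow> bool" where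
  "loewner_le n X Y \<longleftrightarrow>
     (\<forall>v \<in> carrier_vec n. scalar_prod v (X *\<^sub>v v) \<le> scalar_prod v (Y *\<^sub>v v))"

lemma smult_mult_mat_vec:
  fixes A :: "'a :: comm_semiring_0 mat"
  assumes "A \<in> carrier_mat nr nc" "v \<in> carrier_vec nc"
  shows "(k \<cdot>\<^sub>m A) *\<^sub>v v = k \<cdot>\<^sub>v (A *\<^sub>v v)"
  using assms by (intro eq_vecI) (auto simp: scalar_prod_def sum_distrib_left mult.assoc)

lemma mult_mat_zero_vec:
  assumes "A \<in> carrier_mat n m"
  shows "A *\<^sub>v 0\<^sub>v m = 0\<^sub>v n"
  using assms by (intro eq_vecI) (auto simp: scalar_prod_def)

lemma transpose_smult: "transpose_mat (c \<cdot>\<^sub>m A) = c \<cdot>\<^sub>m transpose_mat A"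
  by (intro eq_matI) auto

lemma sym_mat_carrier: "sym_mat n G \<Longrightarrow> G \<in> carrier_mat n n"
  by (simp add: sym_mat_def)

lemma sym_mat_add: "sym_mat n G \<Longrightarrow> sym_mat n H \<Longrightarrow> sym_mat n (G + H)"
  by (auto simp: sym_mat_def transpose_add[of _ n n])

lemma sym_mat_smult: "sym_mat n G \<Longrightarrow> sym_mat n (c \<cdot>\<^sub>m G)"
  by (auto simp: sym_mat_def transpose_smult)

lemma sym_mat_minus: "sym_mat n G \<Longrightarrow> sym_mat n H \<Longrightarrow> sym_mat n (G - H)"
  by (auto simp: sym_mat_def transpose_minus[of _ n n])

lemma sym_mat_sandwich:
  assumes A: "sym_mat n A" and K: "K \<in> carrier_mat n m"
  shows "sym_mat m (transpose_mat K * A * K)"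
proof -
  have Ac: "A \<in> carrier_mat n n" "transpose_mat A = A" using A by (auto simp: sym_mat_def)
  have Kt: "transpose_mat K \<in> carrier_mat m n" using K by simp
  have KA: "transpose_mat K * A \<in> carrier_mat m n" using Kt Ac(1) by (rule mult_carrier_mat)
  have "transpose_mat (transpose_mat K * A * K) = transpose_mat K * (A * K)"
    unfolding transpose_mult[OF KA K] transpose_mult[OF Kt Ac(1)] Ac(2) by simp
  also have "\<dots> = transpose_mat K * A * K" using assoc_mult_mat[OF Kt Ac(1) K] by simp
  finally show ?thesis unfolding sym_mat_def using mult_carrier_mat[OF KA K] by simp
qed

lemma sym_mat_swap:
  assumes "sym_mat n G" "v \<in> carrier_vec n" "w \<in> carrier_vec n"
  shows "scalar_prod v (G *\<^sub>v w) = scalar_prod w (G *\<^sub>v v)"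
proof -
  have G: "G \<in> carrier_mat n n" "transpose_mat G = G" using assms(1) by (auto simp: sym_mat_def)
  have "G *\<^sub>v v \<in> carrier_vec n" using G(1) assms(2) by (rule mult_mat_vec_carrier)
  then show ?thesis
    using transpose_vec_mult_scalar[OF G(1) assms(3,2)] comm_scalar_prod[OF assms(3)] G(2) by simp
qed

lemma spd_mat_sym: "spd_mat n D \<Longrightarrow> sym_mat n D"
  by (simp add: spd_mat_def sym_mat_def)

lemma spd_mat_pos:
  assumes "spd_mat n D" "v \<in> carrier_vec n" "v \<noteq> 0\<^sub>v n"
  shows "scalar_prod v (D *\<^sub>v v) > 0"
proof -
  have "D \<in> carrier_mat n n" using assms(1) by (simp add: spd_mat_def)
  then have "D *\<^sub>v v \<in> carrier_vec n" using assms(2) by (rule mult_mat_vec_carrier)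
  then show ?thesis using assms comm_scalar_prod[OF assms(2)] by (simp add: spd_mat_def)
qed

lemma spd_mat_nonneg:
  assumes "spd_mat n D" "v \<in> carrier_vec n"
  shows "scalar_prod v (D *\<^sub>v v) \<ge> 0"
proof (cases "v = 0\<^sub>v n")
  case True
  have "D *\<^sub>v v \<in> carrier_vec n"
    using sym_mat_carrier[OF spd_mat_sym[OF assms(1)]] assms(2) by (rule mult_mat_vec_carrier)
  then show ?thesis using True by simp
next
  case False
  then show ?thesis using spd_mat_pos[OF assms] by simp
qed

lemma form_smult_mat:
  fixes D :: "real mat"
  assumes "D \<in> carrier_mat n n" "v \<in> carrier_vec n"
  shows "scalar_prod v ((c \<cdot>\<^sub>m D) *\<^sub>v v) = c * scalar_prod v (D *\<^sub>v v)"
  using assms mult_mat_vec_carrier[OF assms] by (simp add: smult_mult_mat_vec[of _ n n])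

lemma form_add:
  assumes G: "sym_mat n G" and v: "v \<in> carrier_vec n" and w: "w \<in> carrier_vec n"
  shows "scalar_prod (v + c \<cdot>\<^sub>v w) (G *\<^sub>v (v + c \<cdot>\<^sub>v w)) =
     scalar_prod v (G *\<^sub>v v) + 2 * c * scalar_prod v (G *\<^sub>v w) + c\<^sup>2 * scalar_prod w (G *\<^sub>v w)"
proof -
  have c: "G \<in> carrier_mat n n" using G by (rule sym_mat_carrier)
  have [simp]: "G *\<^sub>v v \<in> carrier_vec n" "G *\<^sub>v w \<in> carrier_vec n" using c v w by auto
  have "G *\<^sub>v (v + c \<cdot>\<^sub>v w) = G *\<^sub>v v + c \<cdot>\<^sub>v (G *\<^sub>v w)"
    using c v w by (simp add: mult_add_distrib_mat_vec mult_mat_vec)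
  moreover have "scalar_prod w (G *\<^sub>v v) = scalar_prod v (G *\<^sub>v w)"
    using sym_mat_swap[OF G w v] .
  ultimately show ?thesis using v w
    by (simp add: add_scalar_prod_distrib[of _ n] scalar_prod_add_distrib[of _ n]
        power2_eq_square algebra_simps)
qed

lemma form_sandwich:
  fixes A :: "real mat"
  assumes A: "A \<in> carrier_mat n n" and K: "K \<in> carrier_mat n m" and v: "v \<in> carrier_vec m"
  shows "scalar_prod v ((transpose_mat K * A * K) *\<^sub>v v) = scalar_prod (K *\<^sub>v v) (A *\<^sub>v (K *\<^sub>v v))"
proof -
  have Kt: "transpose_mat K \<in> carrier_mat m n" using K by simp
  have Kv: "K *\<^sub>v v \<in> carrier_vec n" using K v by (rule mult_mat_vec_carrier)
  have AKv: "A *\<^sub>v (K *\<^sub>v v) \<in> carrier_vec n" using A Kv by (rule mult_mat_vec_carrier)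
  have "(transpose_mat K * A * K) *\<^sub>v v = transpose_mat K *\<^sub>v (A *\<^sub>v (K *\<^sub>v v))"
    unfolding assoc_mult_mat_vec[OF mult_carrier_mat[OF Kt A] K v]
      assoc_mult_mat_vec[OF Kt A Kv] ..
  moreover have "scalar_prod (K *\<^sub>v v) (A *\<^sub>v (K *\<^sub>v v)) =
      scalar_prod v (transpose_mat K *\<^sub>v (A *\<^sub>v (K *\<^sub>v v)))"
    using transpose_vec_mult_scalar[OF K v AKv] K v AKv Kv
    by (metis comm_scalar_prod mult_mat_vec_carrier Kt)
  ultimately show ?thesis by simp
qed

lemma loewner_le_trans: "loewner_le n X Y \<Longrightarrow> loewner_le n Y Z \<Longrightarrow> loewner_le n X Z"
  unfolding loewner_le_def by (meson order_trans)

lemma loewner_le_smult_mono: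
  assumes "spd_mat n D" "c \<le> d"
  shows "loewner_le n (c \<cdot>\<^sub>m D) (d \<cdot>\<^sub>m D)"
  unfolding loewner_le_def
proof
  fix v :: "real vec" assume v: "v \<in> carrier_vec n"
  have Dc: "D \<in> carrier_mat n n" using assms(1) by (simp add: spd_mat_def)
  show "scalar_prod v ((c \<cdot>\<^sub>m D) *\<^sub>v v) \<le> scalar_prod v ((d \<cdot>\<^sub>m D) *\<^sub>v v)"
    unfolding form_smult_mat[OF Dc v]
    using assms(2) spd_mat_nonneg[OF assms(1) v] by (rule mult_right_mono)
qed

lemma loewner_le_refl_smult:
  assumes "spd_mat n D"
  shows "c \<le> 1 \<Longrightarrow> loewner_le n (c \<cdot>\<^sub>m D) D" and "1 \<le> c \<Longrightarrow> loewner_le n D (c \<cdot>\<^sub>m D)"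
proof -
  have "(1 :: real) \<cdot>\<^sub>m D = D" by (intro eq_matI) auto
  then show "c \<le> 1 \<Longrightarrow> loewner_le n (c \<cdot>\<^sub>m D) D" "1 \<le> c \<Longrightarrow> loewner_le n D (c \<cdot>\<^sub>m D)"
    using loewner_le_smult_mono[OF assms, of c 1] loewner_le_smult_mono[OF assms, of 1 c] by auto
qed

text \<open>
  The quadratic polynomial $c \mapsto (v + c w)^T G (v + c w)$ is nonnegative; take $c$ at its minimum.
  When $w^T G w = 0$ it is affine in $c$ and must be constant.
\<close>

lemma psd_cauchy_schwarz:
  assumes G: "sym_mat n G"
    and psd: "\<And>x. x \<in> carrier_vec n \<Longrightarrow> 0 \<le> scalar_prod x (G *\<^sub>v x)"
    and v: "v \<in> carrier_vec n" and w: "w \<in> carrier_vec n"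
  shows "(scalar_prod v (G *\<^sub>v w))\<^sup>2 \<le> scalar_prod v (G *\<^sub>v v) * scalar_prod w (G *\<^sub>v w)"
proof -
  let ?p = "scalar_prod v (G *\<^sub>v v)" and ?q = "scalar_prod w (G *\<^sub>v w)"
  let ?r = "scalar_prod v (G *\<^sub>v w)"
  have nn: "0 \<le> ?p + 2 * c * ?r + c\<^sup>2 * ?q" for c
    using psd[of "v + c \<cdot>\<^sub>v w"] form_add[OF G v w, of c] v w by simp
  show ?thesis
  proof (cases "?q = 0")
    case True
    have "?r = 0"
    proof (rule ccontr)
      assume "?r \<noteq> 0"
      moreover have "0 \<le> ?p + 2 * (- (?p + 1) / ?r) * ?r" using nn[of "- (?p + 1) / ?r"] True by simp
      ultimately have "0 \<le> - ?p - 2" by simp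
      then show False using psd[OF v] by simp
    qed
    then show ?thesis using True by simp
  next
    case False
    then have q: "?q > 0" using psd[OF w] by simp
    have "?p + 2 * (- ?r / ?q) * ?r + (- ?r / ?q)\<^sup>2 * ?q = ?p - ?r\<^sup>2 / ?q"
      using q by (simp add: field_simps power2_eq_square)
    then have "?r\<^sup>2 / ?q \<le> ?p" using nn[of "- ?r / ?q"] by simp
    then show ?thesis using q by (simp add: pos_divide_le_eq)
  qed
qed

lemma psd_null_vector:
  assumes G: "sym_mat n G"
    and psd: "\<And>x. x \<in> carrier_vec n \<Longrightarrow> 0 \<le> scalar_prod x (G *\<^sub>v x)"
    and v: "v \<in> carrier_vec n" and z: "scalar_prod v (G *\<^sub>v v) = 0"
  shows "G *\<^sub>v v = 0\<^sub>v n"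
proof -
  have c: "G *\<^sub>v v \<in> carrier_vec n" using sym_mat_carrier[OF G] v by simp
  have "scalar_prod (G *\<^sub>v v) (G *\<^sub>v v) = 0"
    using psd_cauchy_schwarz[OF G psd c v] z by simp
  then show ?thesis using conjugate_square_eq_0_vec[OF c] by simp
qed

section \<open>Extremal Rayleigh quotients\<close>

text \<open>
  Vectors are represented by functions on the naturals, since the product topology on that
  type gives compactness for every dimension at once.
\<close>

lemma continuous_coordinate [continuous_intros]:
  "continuous_on S (\<lambda>f :: nat \<Rightarrow> real. f i)"
  by (rule continuous_on_subset[OF continuous_on_product_coordinates]) simp

lemma compact_unit_sphere:
  "compact {f :: nat \<Rightarrow> real. (\<forall>i\<ge>n. f i = 0) \<and> (\<Sum>i<n. (f i)\<^sup>2) = 1}" (is "compact ?S")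
proof -
  let ?B = "PiE UNIV (\<lambda>i. if i < n then {-1..1} else {0::real})"
  have "compact ?B"
    using compactin_PiE[of "\<lambda>_. euclidean :: real topology" "UNIV :: nat set"
        "\<lambda>i. if i < n then {-1..1} else {0::real}"]
    by (simp add: euclidean_product_topology)
  moreover have "closed {f :: nat \<Rightarrow> real. (\<Sum>i<n. (f i)\<^sup>2) = 1}"
    by (intro closed_Collect_eq continuous_intros)
  moreover have "?S = ?B \<inter> {f. (\<Sum>i<n. (f i)\<^sup>2) = 1}"
  proof (intro equalityI subsetI)
    fix f assume f: "f \<in> ?S"
    have "\<bar>f i\<bar> \<le> 1" if "i < n" for i
    proof -
      have "(f i)\<^sup>2 \<le> (\<Sum>i<n. (f i)\<^sup>2)" using that by (intro member_le_sum) auto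
      then show ?thesis using f by (simp add: abs_square_le_1)
    qed
    then show "f \<in> ?B \<inter> {f. (\<Sum>i<n. (f i)\<^sup>2) = 1}" using f by (auto simp: abs_le_iff)
  next
    fix f assume f: "f \<in> ?B \<inter> {f. (\<Sum>i<n. (f i)\<^sup>2) = 1}"
    have "f i = 0" if "n \<le> i" for i
    proof -
      have "f \<in> ?B" using f by (rule IntD1)
      then have "f i \<in> (if i < n then {-1..1} else {0})" by (rule PiE_mem) simp
      then show ?thesis using that by simp
    qed
    then show "f \<in> ?S" using f by simp
  qed
  ultimately show ?thesis by (simp add: compact_Int_closed)
qed

lemma continuous_form:
  assumes "G \<in> carrier_mat n n"
  shows "continuous_on S (\<lambda>f :: nat \<Rightarrow> real. scalar_prod (vec n f) (G *\<^sub>v vec n f))"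
proof -
  have "(\<lambda>f :: nat \<Rightarrow> real. scalar_prod (vec n f) (G *\<^sub>v vec n f)) =
      (\<lambda>f. \<Sum>i<n. f i * (\<Sum>j<n. G $$ (i, j) * f j))"
    using assms by (auto simp: scalar_prod_def atLeast0LessThan intro!: ext sum.cong)
  moreover have "continuous_on S (\<lambda>f :: nat \<Rightarrow> real. \<Sum>i<n. f i * (\<Sum>j<n. G $$ (i, j) * f j))"
    by (intro continuous_intros)
  ultimately show ?thesis by (simp only:)
qed

text \<open>
  The quotient $v^T G v / v^T D v$ is continuous on the compact unit sphere, so it attains its minimum
  $m$ at some $v$, and homogeneity makes $m$ a lower bound for all vectors. Then $G - m D$ is positive semidefinite and vanishes as a quadratic form at $v$,
  which makes $v$ a null vector of $G - m D$.
\<close>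

lemma rayleigh_min_attained:
  assumes n: "n > 0" and G: "sym_mat n G" and D: "spd_mat n D"
  obtains m v where "v \<in> carrier_vec n" "v \<noteq> 0\<^sub>v n" "G *\<^sub>v v = m \<cdot>\<^sub>v (D *\<^sub>v v)"
    "loewner_le n (m \<cdot>\<^sub>m D) G"
proof -
  let ?S = "{f :: nat \<Rightarrow> real. (\<forall>i\<ge>n. f i = 0) \<and> (\<Sum>i<n. (f i)\<^sup>2) = 1}"
  let ?q = "\<lambda>X f. scalar_prod (vec n f) (X *\<^sub>v vec n f)"
  have Gc: "G \<in> carrier_mat n n" and Dc: "D \<in> carrier_mat n n"
    using G D by (auto simp: sym_mat_def spd_mat_def)
  have nz: "vec n f \<noteq> 0\<^sub>v n" if "f \<in> ?S" for f
  proof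
    assume "vec n f = 0\<^sub>v n"
    then have "\<forall>i<n. f i = 0" by (metis index_vec index_zero_vec(1))
    then show False using that by simp
  qed
  have Dpos: "?q D f > 0" if "f \<in> ?S" for f
    using spd_mat_pos[OF D _ nz[OF that]] by simp
  have "(\<Sum>i<n. (if i = 0 then 1 else 0 :: real)\<^sup>2) = (\<Sum>i<n. if i = 0 then 1 else 0)"
    by (intro sum.cong) auto
  also have "\<dots> = 1" using n by (simp add: sum.delta)
  finally have "(\<lambda>i. if i = 0 then 1 else 0) \<in> ?S" using n by simp
  then have ne: "?S \<noteq> {}" by (metis empty_iff)
  have cont: "continuous_on ?S (\<lambda>f. ?q G f / ?q D f)"
  proof (intro continuous_on_divide ballI)
    show "?q D f \<noteq> 0" if "f \<in> ?S" for f using Dpos[OF that] by simp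
  qed (rule continuous_form Gc Dc)+
  obtain f where f: "f \<in> ?S" and fmin: "\<And>g. g \<in> ?S \<Longrightarrow> ?q G f / ?q D f \<le> ?q G g / ?q D g"
    by (rule bexE[OF continuous_attains_inf[OF compact_unit_sphere ne cont]]) (rule that, assumption, erule bspec)
  define m where "m = ?q G f / ?q D f"
  have mult: "scalar_prod w ((m \<cdot>\<^sub>m D) *\<^sub>v w) = m * scalar_prod w (D *\<^sub>v w)"
    if "w \<in> carrier_vec n" for w
    using that Dc by (simp add: smult_mult_mat_vec[of _ n n])
  have le: "m * scalar_prod w (D *\<^sub>v w) \<le> scalar_prod w (G *\<^sub>v w)" if w: "w \<in> carrier_vec n" for w
  proof (cases "w = 0\<^sub>v n")
    case True
    then show ?thesis using Gc Dc by (simp add: mult_mat_vec_carrier[of _ n n])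
  next
    case False
    define s where "s = sqrt (\<Sum>i<n. (w $ i)\<^sup>2)"
    obtain i where i: "i < n" "w $ i \<noteq> 0"
      using False w by (metis carrier_vecD eq_vecI index_zero_vec(1) index_zero_vec(2))
    have "0 < (\<Sum>i<n. (w $ i)\<^sup>2)" using i by (intro sum_pos2[of _ i]) auto
    then have s: "s > 0" "s\<^sup>2 = (\<Sum>i<n. (w $ i)\<^sup>2)" by (auto simp: s_def)
    define g where "g = (\<lambda>i. if i < n then w $ i / s else 0)"
    have "(\<Sum>i<n. (g i)\<^sup>2) = (\<Sum>i<n. (w $ i)\<^sup>2 / s\<^sup>2)"
      by (intro sum.cong) (auto simp: g_def power_divide)
    also have "\<dots> = s\<^sup>2 / s\<^sup>2" unfolding s(2) sum_divide_distrib ..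
    finally have "(\<Sum>i<n. (g i)\<^sup>2) = 1" using s(1) by simp
    moreover have "\<forall>i\<ge>n. g i = 0" by (simp add: g_def)
    ultimately have g: "g \<in> ?S" by blast
    have "w = s \<cdot>\<^sub>v vec n g" using w s(1) by (intro eq_vecI) (auto simp: g_def)
    then have sc: "scalar_prod w (X *\<^sub>v w) = s\<^sup>2 * ?q X g" if "X \<in> carrier_mat n n" for X
    proof -
      have "X *\<^sub>v w = s \<cdot>\<^sub>v (X *\<^sub>v vec n g)"
        unfolding \<open>w = _\<close> by (rule mult_mat_vec[OF that]) simp
      moreover have "X *\<^sub>v vec n g \<in> carrier_vec n" using that by (rule mult_mat_vec_carrier) simp
      ultimately show ?thesis
        unfolding power2_eq_square mult.assoc
        by (subst (1) \<open>w = _\<close>) (simp only: scalar_prod_smult_distrib[of _ n] smult_scalar_prod_distrib[of _ n] vec_carrier smult_carrier_vec)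
    qed
    have "m * ?q D g \<le> ?q G g"
      using fmin[OF g] Dpos[OF g] by (simp add: m_def pos_le_divide_eq)
    then have "s\<^sup>2 * (m * ?q D g) \<le> s\<^sup>2 * ?q G g" by (intro mult_left_mono) auto
    then show ?thesis unfolding sc[OF Gc] sc[OF Dc] mult.left_commute[of m] .
  qed
  define v where "v = vec n f"
  have v: "v \<in> carrier_vec n" "v \<noteq> 0\<^sub>v n" using nz[OF f] by (auto simp: v_def)
  let ?H = "G - m \<cdot>\<^sub>m D"
  have H: "sym_mat n ?H"
    by (intro sym_mat_minus sym_mat_smult G spd_mat_sym[OF D])
  have Hv: "?H *\<^sub>v w = G *\<^sub>v w - m \<cdot>\<^sub>v (D *\<^sub>v w)" if "w \<in> carrier_vec n" for w
    using that Gc Dc minus_mult_distrib_mat_vec[OF Gc, of "m \<cdot>\<^sub>m D" w]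
    by (simp add: smult_mult_mat_vec[of _ n n])
  have Hf: "scalar_prod w (?H *\<^sub>v w) = scalar_prod w (G *\<^sub>v w) - m * scalar_prod w (D *\<^sub>v w)"
    if "w \<in> carrier_vec n" for w
  proof -
    have "G *\<^sub>v w \<in> carrier_vec n" "D *\<^sub>v w \<in> carrier_vec n"
      using that Gc Dc mult_mat_vec_carrier by blast+
    then show ?thesis using that scalar_prod_minus_distrib[of w n "G *\<^sub>v w" "m \<cdot>\<^sub>v (D *\<^sub>v w)"]
      by (simp add: Hv)
  qed
  have "scalar_prod v (?H *\<^sub>v v) = 0"
    using Hf[OF v(1)] Dpos[OF f] by (simp add: v_def m_def)
  moreover have "0 \<le> scalar_prod w (?H *\<^sub>v w)" if "w \<in> carrier_vec n" for w
    using le[OF that] Hf[OF that] by simp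
  ultimately have "?H *\<^sub>v v = 0\<^sub>v n"
    by (intro psd_null_vector[OF H _ v(1)])
  then have e: "G *\<^sub>v v - m \<cdot>\<^sub>v (D *\<^sub>v v) = 0\<^sub>v n" using Hv[OF v(1)] by simp
  have "G *\<^sub>v v = m \<cdot>\<^sub>v (D *\<^sub>v v)"
  proof (intro eq_vecI)
    fix i assume "i < dim_vec (m \<cdot>\<^sub>v (D *\<^sub>v v))"
    then have i: "i < n" using Dc by simp
    then have "(G *\<^sub>v v - m \<cdot>\<^sub>v (D *\<^sub>v v)) $ i = 0" using e by simp
    then show "(G *\<^sub>v v) $ i = (m \<cdot>\<^sub>v (D *\<^sub>v v)) $ i" using i Gc Dc by simp
  qed (use Gc Dc in simp)
  moreover have "loewner_le n (m \<cdot>\<^sub>m D) G"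
    using le mult by (simp add: loewner_le_def)
  ultimately show thesis by (rule that[OF v])
qed

corollary rayleigh_max_attained:
  assumes n: "n > 0" and G: "sym_mat n G" and D: "spd_mat n D"
  obtains m v where "v \<in> carrier_vec n" "v \<noteq> 0\<^sub>v n" "G *\<^sub>v v = m \<cdot>\<^sub>v (D *\<^sub>v v)"
    "loewner_le n G (m \<cdot>\<^sub>m D)"
proof -
  have Gc: "G \<in> carrier_mat n n" and Dc: "D \<in> carrier_mat n n"
    using G D by (auto simp: sym_mat_def spd_mat_def)
  obtain m v where v: "v \<in> carrier_vec n" "v \<noteq> 0\<^sub>v n"
    and e: "((-1) \<cdot>\<^sub>m G) *\<^sub>v v = m \<cdot>\<^sub>v (D *\<^sub>v v)"
    and le: "loewner_le n (m \<cdot>\<^sub>m D) ((-1) \<cdot>\<^sub>m G)"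
    using rayleigh_min_attained[OF n sym_mat_smult[OF G] D] .
  have e': "(-1) \<cdot>\<^sub>v (G *\<^sub>v v) = m \<cdot>\<^sub>v (D *\<^sub>v v)"
    using e smult_mult_mat_vec[OF Gc v(1)] by simp
  have "G *\<^sub>v v = (-1) \<cdot>\<^sub>v ((-1) \<cdot>\<^sub>v (G *\<^sub>v v))" by (simp add: smult_smult_assoc)
  also have "\<dots> = (- m) \<cdot>\<^sub>v (D *\<^sub>v v)" unfolding e' by (simp add: smult_smult_assoc)
  finally have "G *\<^sub>v v = (- m) \<cdot>\<^sub>v (D *\<^sub>v v)" .
  moreover have "loewner_le n G ((- m) \<cdot>\<^sub>m D)"
    using le by (auto simp: loewner_le_def form_smult_mat[OF Dc] form_smult_mat[OF Gc] minus_le_iff le_minus_iff)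
  ultimately show thesis by (rule that[OF v])
qed

section \<open>Inverses\<close>

lemma minv_inverts:
  assumes A: "A \<in> carrier_mat n n" and d: "det A \<noteq> 0"
  shows "minv A \<in> carrier_mat n n" "A * minv A = 1\<^sub>m n" "minv A * A = 1\<^sub>m n"
proof -
  obtain X where "mat_inverse A = Some X"
    using mat_inverse(1)[OF A, of "()"] det_non_zero_imp_unit[OF A d, of "()"] by auto
  then show "minv A \<in> carrier_mat n n" "A * minv A = 1\<^sub>m n" "minv A * A = 1\<^sub>m n"
    using mat_inverse(2)[OF A] by (auto simp: minv_def)
qed

lemma invertible_mat_det:
  fixes A :: "'a :: field mat"
  assumes A: "A \<in> carrier_mat n n" and inv: "invertible_mat A"
  shows "det A \<noteq> 0"
proof -
  obtain B where AB: "A * B = 1\<^sub>m (dim_row A)" and BA: "B * A = 1\<^sub>m (dim_row B)"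
    using inv unfolding invertible_mat_def inverts_mat_def by blast
  have "dim_col B = n" using arg_cong[OF AB, of dim_col] A by simp
  moreover have "dim_row B = n" using arg_cong[OF BA, of dim_col] A by simp
  ultimately have B: "B \<in> carrier_mat n n" by blast
  have "det A * det B = 1" using det_mult[OF A B] AB A by simp
  then show ?thesis by auto
qed

lemma spd_mat_det:
  assumes "spd_mat n A"
  shows "det A \<noteq> 0"
proof
  assume "det A = 0"
  moreover have "A \<in> carrier_mat n n" using assms by (simp add: spd_mat_def)
  ultimately obtain v where v: "v \<in> carrier_vec n" "v \<noteq> 0\<^sub>v n" "A *\<^sub>v v = 0\<^sub>v n"
    using det_0_iff_vec_prod_zero_field by blast
  then show False using spd_mat_pos[OF assms v(1,2)] by simp
qed

lemma spd_minv_inverts: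
  assumes "spd_mat n A"
  shows "minv A \<in> carrier_mat n n" "A * minv A = 1\<^sub>m n" "minv A * A = 1\<^sub>m n"
  using minv_inverts[of A n] spd_mat_det[OF assms] assms by (auto simp: spd_mat_def)

lemma spd_minv_apply:
  assumes A: "spd_mat n A" and v: "v \<in> carrier_vec n"
  shows "A *\<^sub>v (minv A *\<^sub>v v) = v" "minv A *\<^sub>v (A *\<^sub>v v) = v"
proof -
  have Ac: "A \<in> carrier_mat n n" using A by (simp add: spd_mat_def)
  note m = spd_minv_inverts[OF A]
  show "A *\<^sub>v (minv A *\<^sub>v v) = v"
    using assoc_mult_mat_vec[OF Ac m(1) v] m(2) v by simp
  show "minv A *\<^sub>v (A *\<^sub>v v) = v"
    using assoc_mult_mat_vec[OF m(1) Ac v] m(3) v by simp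
qed

lemma spd_minv:
  assumes A: "spd_mat n A"
  shows "spd_mat n (minv A)"
proof -
  have Ac: "A \<in> carrier_mat n n" and At: "transpose_mat A = A" using A by (auto simp: spd_mat_def)
  note m = spd_minv_inverts[OF A]
  have mt: "transpose_mat (minv A) \<in> carrier_mat n n" using m(1) by simp
  have "transpose_mat (minv A) = transpose_mat (minv A) * (A * minv A)"
    using m(2) mt by simp
  also have "\<dots> = transpose_mat (A * minv A) * minv A"
    using assoc_mult_mat[OF mt Ac m(1)] transpose_mult[OF Ac m(1)] At by simp
  also have "\<dots> = minv A" using m(1,2) by simp
  finally have sym: "transpose_mat (minv A) = minv A" .
  have "scalar_prod (minv A *\<^sub>v v) v > 0" if v: "v \<in> carrier_vec n" "v \<noteq> 0\<^sub>v n" for v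
  proof -
    let ?u = "minv A *\<^sub>v v"
    have u: "?u \<in> carrier_vec n" using m(1) v(1) by (rule mult_mat_vec_carrier)
    have "?u \<noteq> 0\<^sub>v n"
    proof
      assume "?u = 0\<^sub>v n"
      then have "v = A *\<^sub>v 0\<^sub>v n" using spd_minv_apply(1)[OF A v(1)] by simp
      then show False using v(2) mult_mat_zero_vec[OF Ac] by simp
    qed
    then show ?thesis using spd_mat_pos[OF A u] spd_minv_apply(1)[OF A v(1)] by simp
  qed
  then show ?thesis using m(1) sym by (simp add: spd_mat_def)
qed

section \<open>Spectral bounds as Loewner bounds\<close>

lemma spectrum_iff:
  assumes "X \<in> carrier_mat n n"
  shows "k \<in> spectrum X \<longleftrightarrow> (\<exists>v \<in> carrier_vec n. v \<noteq> 0\<^sub>v n \<and> X *\<^sub>v v = k \<cdot>\<^sub>v v)"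
  using assms by (auto simp: spectrum_def eigenvalue_def eigenvector_def)

text \<open>
  The extremal vectors of the Rayleigh quotient of $B$ against $A^{-1}$ are eigenvectors of $BA$
  after the substitution $u = A^{-1} v$.
\<close>

lemma pencil_eigenvalue:
  assumes A: "spd_mat n A" and B: "B \<in> carrier_mat n n"
    and v: "v \<in> carrier_vec n" "v \<noteq> 0\<^sub>v n" and e: "B *\<^sub>v v = k \<cdot>\<^sub>v (minv A *\<^sub>v v)"
  shows "k \<in> spectrum (B * A)"
proof -
  have Ac: "A \<in> carrier_mat n n" using A by (simp add: spd_mat_def)
  let ?u = "minv A *\<^sub>v v"
  have u: "?u \<in> carrier_vec n" using spd_minv_inverts(1)[OF A] v(1) by (rule mult_mat_vec_carrier)
  have "?u \<noteq> 0\<^sub>v n"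
    using spd_minv_apply(1)[OF A v(1)] v(2) mult_mat_zero_vec[OF Ac] by auto
  moreover have "(B * A) *\<^sub>v ?u = k \<cdot>\<^sub>v ?u"
    using assoc_mult_mat_vec[OF B Ac u] spd_minv_apply(1)[OF A v(1)] e by simp
  ultimately show ?thesis using u spectrum_iff[OF mult_carrier_mat[OF B Ac]] by blast
qed

lemma spectrum_rayleigh_quotient:
  assumes A: "spd_mat n A" and B: "sym_mat n B" and k: "k \<in> spectrum (B * A)"
  obtains w where "w \<in> carrier_vec n" "scalar_prod w (minv A *\<^sub>v w) > 0"
    "scalar_prod w (B *\<^sub>v w) = k * scalar_prod w (minv A *\<^sub>v w)"
proof -
  have Ac: "A \<in> carrier_mat n n" using A by (simp add: spd_mat_def)
  have Bc: "B \<in> carrier_mat n n" using B by (rule sym_mat_carrier)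
  obtain u where u: "u \<in> carrier_vec n" "u \<noteq> 0\<^sub>v n" and e: "(B * A) *\<^sub>v u = k \<cdot>\<^sub>v u"
    using k spectrum_iff[OF mult_carrier_mat[OF Bc Ac]] by blast
  let ?w = "A *\<^sub>v u"
  have w: "?w \<in> carrier_vec n" using Ac u(1) by (rule mult_mat_vec_carrier)
  have "scalar_prod ?w (minv A *\<^sub>v ?w) > 0"
    using spd_mat_pos[OF A u] comm_scalar_prod[OF u(1) w] spd_minv_apply(2)[OF A u(1)] by simp
  moreover have "B *\<^sub>v ?w = k \<cdot>\<^sub>v u" using e assoc_mult_mat_vec[OF Bc Ac u(1)] by simp
  then have "scalar_prod ?w (B *\<^sub>v ?w) = k * scalar_prod ?w (minv A *\<^sub>v ?w)"
    using w u(1) spd_minv_apply(2)[OF A u(1)] by simp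
  ultimately show thesis using that[OF w] by blast
qed

lemma spectrum_lower:
  assumes A: "spd_mat n A" and B: "sym_mat n B" and le: "loewner_le n (c \<cdot>\<^sub>m minv A) B"
    and k: "k \<in> spectrum (B * A)"
  shows "c \<le> k"
proof -
  obtain w where w: "w \<in> carrier_vec n" "scalar_prod w (minv A *\<^sub>v w) > 0"
    "scalar_prod w (B *\<^sub>v w) = k * scalar_prod w (minv A *\<^sub>v w)"
    using spectrum_rayleigh_quotient[OF A B k] .
  then have "c * scalar_prod w (minv A *\<^sub>v w) \<le> k * scalar_prod w (minv A *\<^sub>v w)"
    using le form_smult_mat[OF spd_minv_inverts(1)[OF A] w(1)] by (auto simp: loewner_le_def)
  then show ?thesis using w(2) by simp
qed

lemma spectrum_upper:
  assumes A: "spd_mat n A" and B: "sym_mat n B" and le: "loewner_le n B (c \<cdot>\<^sub>m minv A)"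
    and k: "k \<in> spectrum (B * A)"
  shows "k \<le> c"
proof -
  obtain w where w: "w \<in> carrier_vec n" "scalar_prod w (minv A *\<^sub>v w) > 0"
    "scalar_prod w (B *\<^sub>v w) = k * scalar_prod w (minv A *\<^sub>v w)"
    using spectrum_rayleigh_quotient[OF A B k] .
  then have "k * scalar_prod w (minv A *\<^sub>v w) \<le> c * scalar_prod w (minv A *\<^sub>v w)"
    using le form_smult_mat[OF spd_minv_inverts(1)[OF A] w(1)] by (auto simp: loewner_le_def)
  then show ?thesis using w(2) by simp
qed

lemma spectrum_nonempty_finite:
  assumes n: "n > 0" and A: "spd_mat n A" and B: "sym_mat n B"
  shows "spectrum (B * A) \<noteq> {}" "finite (spectrum (B * A))"
proof -
  have Bc: "B \<in> carrier_mat n n" using B by (rule sym_mat_carrier)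
  then show "finite (spectrum (B * A))"
    using A by (intro card_finite_spectrum(1)[of _ n]) (simp add: spd_mat_def)
  obtain m v where "v \<in> carrier_vec n" "v \<noteq> 0\<^sub>v n" "B *\<^sub>v v = m \<cdot>\<^sub>v (minv A *\<^sub>v v)"
    using rayleigh_min_attained[OF n B spd_minv[OF A]] by metis
  then show "spectrum (B * A) \<noteq> {}" using pencil_eigenvalue[OF A Bc] by blast
qed

lemma loewner_ge_of_lambda_min:
  assumes n: "n > 0" and A: "spd_mat n A" and B: "sym_mat n B"
    and c: "c \<le> lambda_min (B * A)"
  shows "loewner_le n (c \<cdot>\<^sub>m minv A) B"
proof -
  obtain m v where "v \<in> carrier_vec n" "v \<noteq> 0\<^sub>v n" "B *\<^sub>v v = m \<cdot>\<^sub>v (minv A *\<^sub>v v)"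
    and le: "loewner_le n (m \<cdot>\<^sub>m minv A) B"
    using rayleigh_min_attained[OF n B spd_minv[OF A]] by metis
  then have "m \<in> spectrum (B * A)" by (intro pencil_eigenvalue[OF A sym_mat_carrier[OF B]])
  then have "c \<le> m"
    using c Min_le[OF spectrum_nonempty_finite(2)[OF n A B]] unfolding lambda_min_def by fastforce
  then show ?thesis using loewner_le_smult_mono[OF spd_minv[OF A]] le loewner_le_trans by blast
qed

lemma loewner_le_of_lambda_max:
  assumes n: "n > 0" and A: "spd_mat n A" and B: "sym_mat n B"
    and c: "lambda_max (B * A) \<le> c"
  shows "loewner_le n B (c \<cdot>\<^sub>m minv A)"
proof -
  obtain m v where "v \<in> carrier_vec n" "v \<noteq> 0\<^sub>v n" "B *\<^sub>v v = m \<cdot>\<^sub>v (minv A *\<^sub>v v)"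
    and le: "loewner_le n B (m \<cdot>\<^sub>m minv A)"
    using rayleigh_max_attained[OF n B spd_minv[OF A]] by metis
  then have "m \<in> spectrum (B * A)" by (intro pencil_eigenvalue[OF A sym_mat_carrier[OF B]])
  then have "m \<le> c"
    using c Max_ge[OF spectrum_nonempty_finite(2)[OF n A B]] unfolding lambda_max_def by fastforce
  then show ?thesis using loewner_le_smult_mono[OF spd_minv[OF A]] le loewner_le_trans by blast
qed

text \<open>
  For an eigenvector $x + i y$ with eigenvalue $z$, compare the real and imaginary parts of the
  eigenvalue equation: symmetry of $AX$ gives $\mathrm{Im}\, z\, (x^T A x + y^T A y) = 0$.
  Then $x$ and $y$ satisfy the real eigenvalue equation, and one of them is nonzero.
\<close>

lemma selfadjoint_complex_eigenvalue_real:
  assumes A: "spd_mat n A" and X: "X \<in> carrier_mat n n" and AX: "sym_mat n (A * X)"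
    and z: "eigenvalue (map_mat complex_of_real X) z"
  obtains k where "z = complex_of_real k" "k \<in> spectrum X"
proof -
  have Ac: "A \<in> carrier_mat n n" using A by (simp add: spd_mat_def)
  obtain u where u: "u \<in> carrier_vec n" "u \<noteq> 0\<^sub>v n"
    and e: "map_mat complex_of_real X *\<^sub>v u = z \<cdot>\<^sub>v u"
    using z X by (auto simp: eigenvalue_def eigenvector_def)
  define x y where "x = map_vec Re u" and "y = map_vec Im u"
  have x: "x \<in> carrier_vec n" and y: "y \<in> carrier_vec n" using u by (auto simp: x_def y_def)
  have ei: "(\<Sum>j<n. complex_of_real (X $$ (i, j)) * u $ j) = z * u $ i" if "i < n" for i
    using arg_cong[OF e, of "\<lambda>v. v $ i"] that X u(1) by (simp add: scalar_prod_def atLeast0LessThan)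
  have Xx: "X *\<^sub>v x = Re z \<cdot>\<^sub>v x + (- Im z) \<cdot>\<^sub>v y"
  proof (rule eq_vecI)
    fix i assume "i < dim_vec (Re z \<cdot>\<^sub>v x + (- Im z) \<cdot>\<^sub>v y)"
    then have i: "i < n" using y by simp
    show "(X *\<^sub>v x) $ i = (Re z \<cdot>\<^sub>v x + (- Im z) \<cdot>\<^sub>v y) $ i"
      using arg_cong[OF ei[OF i], of Re] i X u(1)
      by (simp add: x_def y_def scalar_prod_def atLeast0LessThan)
  qed (use X y in simp)
  have Xy: "X *\<^sub>v y = Re z \<cdot>\<^sub>v y + Im z \<cdot>\<^sub>v x"
  proof (rule eq_vecI)
    fix i assume "i < dim_vec (Re z \<cdot>\<^sub>v y + Im z \<cdot>\<^sub>v x)"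
    then have i: "i < n" using x by simp
    show "(X *\<^sub>v y) $ i = (Re z \<cdot>\<^sub>v y + Im z \<cdot>\<^sub>v x) $ i"
      using arg_cong[OF ei[OF i], of Im] i X u(1)
      by (simp add: x_def y_def scalar_prod_def atLeast0LessThan)
  qed (use X x in simp)
  have nz: "x \<noteq> 0\<^sub>v n \<or> y \<noteq> 0\<^sub>v n"
  proof (rule ccontr)
    assume "\<not> ?thesis"
    then have xy: "x = 0\<^sub>v n" "y = 0\<^sub>v n" by auto
    have "u = 0\<^sub>v n"
    proof (rule eq_vecI)
      fix i assume "i < dim_vec (0\<^sub>v n :: complex vec)"
      then have i: "i < n" by simp
      have "Re (u $ i) = 0" "Im (u $ i) = 0"
        using arg_cong[OF xy(1), of "\<lambda>v. v $ i"] arg_cong[OF xy(2), of "\<lambda>v. v $ i"] i u(1)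
        by (auto simp: x_def y_def)
      then show "u $ i = 0\<^sub>v n $ i" using i by (simp add: complex_eq_iff)
    qed (use u in simp)
    then show False using u(2) by simp
  qed
  have Axc: "A *\<^sub>v x \<in> carrier_vec n" and Ayc: "A *\<^sub>v y \<in> carrier_vec n"
    using Ac x y by (auto intro: mult_mat_vec_carrier)
  have AXx: "(A * X) *\<^sub>v x = Re z \<cdot>\<^sub>v (A *\<^sub>v x) + (- Im z) \<cdot>\<^sub>v (A *\<^sub>v y)"
    using assoc_mult_mat_vec[OF Ac X x] Xx Ac x y
    by (simp add: mult_add_distrib_mat_vec[of _ n n] mult_mat_vec[of _ n n])
  have AXy: "(A * X) *\<^sub>v y = Re z \<cdot>\<^sub>v (A *\<^sub>v y) + Im z \<cdot>\<^sub>v (A *\<^sub>v x)"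
    using assoc_mult_mat_vec[OF Ac X y] Xy Ac x y
    by (simp add: mult_add_distrib_mat_vec[of _ n n] mult_mat_vec[of _ n n])
  have 1: "scalar_prod x ((A * X) *\<^sub>v y) =
      Re z * scalar_prod x (A *\<^sub>v y) + Im z * scalar_prod x (A *\<^sub>v x)"
    unfolding AXy using x Axc Ayc by (simp add: scalar_prod_add_distrib[of _ n])
  have 2: "scalar_prod y ((A * X) *\<^sub>v x) =
      Re z * scalar_prod y (A *\<^sub>v x) + (- Im z) * scalar_prod y (A *\<^sub>v y)"
    unfolding AXx using y Axc Ayc by (simp add: scalar_prod_add_distrib[of _ n])
  have "Im z * (scalar_prod x (A *\<^sub>v x) + scalar_prod y (A *\<^sub>v y)) = 0"
    using 1 2 sym_mat_swap[OF AX x y] sym_mat_swap[OF spd_mat_sym[OF A] x y]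
    by (simp add: algebra_simps)
  moreover have "scalar_prod x (A *\<^sub>v x) + scalar_prod y (A *\<^sub>v y) > 0"
    using nz spd_mat_pos[OF A x] spd_mat_pos[OF A y] spd_mat_nonneg[OF A x] spd_mat_nonneg[OF A y]
    by (auto intro: add_pos_nonneg add_nonneg_pos)
  ultimately have im: "Im z = 0" by simp
  then have "X *\<^sub>v x = Re z \<cdot>\<^sub>v x" "X *\<^sub>v y = Re z \<cdot>\<^sub>v y" using Xx Xy x y by auto
  then have "Re z \<in> spectrum X" using nz x y spectrum_iff[OF X] by blast
  moreover have "z = complex_of_real (Re z)" using im by (simp add: complex_eq_iff)
  ultimately show thesis using that by blast
qed

lemma kappa_le_of_bounds:
  assumes n: "n > 0" and A: "spd_mat n A" and B: "sym_mat n B" and c: "0 < c"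
    and lo: "loewner_le n (c \<cdot>\<^sub>m minv A) B" and up: "loewner_le n B (C \<cdot>\<^sub>m minv A)"
  shows "kappa_le (B * A) (C / c)"
proof -
  have Ac: "A \<in> carrier_mat n n" "transpose_mat A = A" using A by (auto simp: spd_mat_def)
  have Bc: "B \<in> carrier_mat n n" using B by (rule sym_mat_carrier)
  have BA: "B * A \<in> carrier_mat n n" using Bc Ac(1) by (rule mult_carrier_mat)
  note ne = spectrum_nonempty_finite[OF n A B]
  have "sym_mat n (A * (B * A))"
    using sym_mat_sandwich[OF B Ac(1)] assoc_mult_mat[OF Ac(1) Bc Ac(1)] Ac(2) by simp
  then have "z \<in> \<real> \<and> 0 < Re z" if "eigenvalue (map_mat complex_of_real (B * A)) z" for z
    using selfadjoint_complex_eigenvalue_real[OF A BA _ that] spectrum_lower[OF A B lo] c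
    by (metis Re_complex_of_real Reals_of_real less_le_trans)
  moreover have "lambda_max (B * A) \<le> C / c * lambda_min (B * A)"
  proof -
    have "lambda_max (B * A) \<in> spectrum (B * A)" unfolding lambda_max_def using ne by (rule Max_in[rotated])
    then have up': "lambda_max (B * A) \<le> C" by (rule spectrum_upper[OF A B up])
    have "lambda_min (B * A) \<in> spectrum (B * A)" unfolding lambda_min_def using ne by (rule Min_in[rotated])
    then have lo': "c \<le> lambda_min (B * A)" and "lambda_min (B * A) \<le> C"
      using spectrum_lower[OF A B lo] spectrum_upper[OF A B up] by auto
    then have "C \<ge> 0" using c by simp
    have "lambda_max (B * A) \<le> C / c * c" using up' c by simp
    also have "\<dots> \<le> C / c * lambda_min (B * A)" using lo' \<open>C \<ge> 0\<close> c by (intro mult_left_mono) auto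
    finally show ?thesis .
  qed
  ultimately show ?thesis unfolding kappa_le_def by blast
qed

section \<open>Nonexpansive smoothers\<close>

text \<open>
  A supremum of reals is an upper bound only for a set that is bounded above. The quotients are bounded
  here because $T^T A T \le m A$ for the largest Rayleigh quotient $m$ of $T^T A T$ against $A$.
\<close>

lemma energy_norm_le_opnorm:
  assumes A: "spd_mat n A" and T: "T \<in> carrier_mat n n" and v: "v \<in> carrier_vec n" "v \<noteq> 0\<^sub>v n"
  shows "energy_norm A (T *\<^sub>v v) \<le> energy_opnorm A T * energy_norm A v"
proof -
  have Ac: "A \<in> carrier_mat n n" using A by (simp add: spd_mat_def)
  have n: "n > 0" using v by (cases n) auto
  have en: "energy_norm A w = sqrt (scalar_prod w (A *\<^sub>v w))" if "w \<in> carrier_vec n" for w :: "real vec"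
    using comm_scalar_prod[OF that mult_mat_vec_carrier[OF Ac that]] by (simp add: energy_norm_def)
  let ?G = "transpose_mat T * A * T"
  obtain m where "loewner_le n ?G (m \<cdot>\<^sub>m A)"
    using rayleigh_max_attained[OF n sym_mat_sandwich[OF spd_mat_sym[OF A] T] A] by metis
  then have m: "scalar_prod (T *\<^sub>v w) (A *\<^sub>v (T *\<^sub>v w)) \<le> m * scalar_prod w (A *\<^sub>v w)"
    if "w \<in> carrier_vec n" for w :: "real vec"
    using that by (simp add: loewner_le_def form_sandwich[OF Ac T] form_smult_mat[OF Ac])
  let ?D = "carrier_vec (dim_row A) - {0\<^sub>v (dim_row A)}"
  let ?f = "\<lambda>v. energy_norm A (T *\<^sub>v v) / energy_norm A v"
  have "bdd_above (?f ` ?D)"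
  proof (rule bdd_aboveI2)
    fix w :: "real vec" assume "w \<in> ?D"
    then have w: "w \<in> carrier_vec n" "w \<noteq> 0\<^sub>v n" using Ac by auto
    have pos: "0 < scalar_prod w (A *\<^sub>v w)" by (rule spd_mat_pos[OF A w])
    have "?f w = sqrt (scalar_prod (T *\<^sub>v w) (A *\<^sub>v (T *\<^sub>v w)) / scalar_prod w (A *\<^sub>v w))"
      using en[OF w(1)] en[OF mult_mat_vec_carrier[OF T w(1)]] by (simp add: real_sqrt_divide)
    also have "\<dots> \<le> sqrt m"
      using m[OF w(1)] pos by (simp add: pos_divide_le_eq)
    finally show "?f w \<le> sqrt m" .
  qed
  then have "?f v \<le> energy_opnorm A T"
    unfolding energy_opnorm_def using v Ac by (intro cSUP_upper) auto
  moreover have "energy_norm A v > 0" using en[OF v(1)] spd_mat_pos[OF A v] by simp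
  ultimately show ?thesis by (simp add: pos_divide_le_eq)
qed

lemma sym_smoother_eq:
  assumes A: "A \<in> carrier_mat n n" and M: "M \<in> carrier_mat n n" and inv: "invertible_mat M"
  shows "sym_smoother A M = M + transpose_mat M - transpose_mat M * A * M"
proof -
  let ?X = "minv M" and ?T = "transpose_mat M"
  note m = minv_inverts[OF M invertible_mat_det[OF M inv]]
  have T: "?T \<in> carrier_mat n n" and Xt: "transpose_mat ?X \<in> carrier_mat n n" using M m(1) by auto
  have TX: "?T * ?X \<in> carrier_mat n n" and TA: "?T * A \<in> carrier_mat n n" using T m(1) A by auto
  have S: "?X + transpose_mat ?X \<in> carrier_mat n n" using m(1) by simp
  have 1: "?T * transpose_mat ?X = 1\<^sub>m n"
    using transpose_mult[OF m(1) M] m(3) by simp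
  have "?T * (?X + transpose_mat ?X - A) = ?T * ?X + 1\<^sub>m n - ?T * A"
    unfolding mult_minus_distrib_mat[OF T S A] mult_add_distrib_mat[OF T m(1) Xt] 1 ..
  then have "sym_smoother A M = (?T * ?X + 1\<^sub>m n - ?T * A) * M" by (simp add: sym_smoother_def)
  also have "\<dots> = ?T * ?X * M + 1\<^sub>m n * M - ?T * A * M"
    using minus_mult_distrib_mat[OF add_carrier_mat[OF one_carrier_mat] TA M]
      add_mult_distrib_mat[OF TX one_carrier_mat M] by simp
  also have "?T * ?X * M = ?T" using assoc_mult_mat[OF T m(1) M] m(3) T by simp
  also have "?T + 1\<^sub>m n * M = M + ?T" using M T comm_add_mat[OF T M] by simp
  finally show ?thesis .
qed

lemma sym_mat_sym_smoother:
  assumes A: "spd_mat n A" and M: "M \<in> carrier_mat n n" and inv: "invertible_mat M"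
  shows "sym_mat n (sym_smoother A M)"
proof -
  have Ac: "A \<in> carrier_mat n n" using A by (simp add: spd_mat_def)
  have Mt: "transpose_mat M \<in> carrier_mat n n" using M by simp
  have "sym_mat n (M + transpose_mat M)"
    unfolding sym_mat_def transpose_add[OF M Mt] using M comm_add_mat[OF M Mt] by simp
  then show ?thesis
    unfolding sym_smoother_eq[OF Ac M inv]
    by (intro sym_mat_minus sym_mat_sandwich[OF spd_mat_sym[OF A] M])
qed

text \<open>
  With $v = A^{-1} w$ one has $\|v\|_A^2 - \|(I - MA) v\|_A^2 = w^T \overline M w$.
\<close>

lemma nonexpansive_smoother_psd:
  assumes A: "spd_mat n A" and M: "M \<in> carrier_mat n n" and inv: "invertible_mat M"
    and ne: "energy_opnorm A (1\<^sub>m n - M * A) \<le> 1" and w: "w \<in> carrier_vec n"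
  shows "0 \<le> scalar_prod w (sym_smoother A M *\<^sub>v w)"
proof (cases "w = 0\<^sub>v n")
  case True
  have "sym_smoother A M *\<^sub>v w \<in> carrier_vec n"
    using sym_mat_carrier[OF sym_mat_sym_smoother[OF A M inv]] w by (rule mult_mat_vec_carrier)
  then show ?thesis using True by simp
next
  case False
  have Ac: "A \<in> carrier_mat n n" using A by (simp add: spd_mat_def)
  have As: "sym_mat n A" using A by (rule spd_mat_sym)
  have Mt: "transpose_mat M \<in> carrier_mat n n" using M by simp
  have MA: "M * A \<in> carrier_mat n n" using M Ac by (rule mult_carrier_mat)
  let ?T = "1\<^sub>m n - M * A"
  have T: "?T \<in> carrier_mat n n" using MA by (rule minus_carrier_mat)
  define v where "v = minv A *\<^sub>v w"
  have v: "v \<in> carrier_vec n"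
    unfolding v_def using spd_minv_inverts(1)[OF A] w by (rule mult_mat_vec_carrier)
  have Av: "A *\<^sub>v v = w" unfolding v_def by (rule spd_minv_apply(1)[OF A w])
  have v0: "v \<noteq> 0\<^sub>v n" using Av False mult_mat_zero_vec[OF Ac] by auto
  have Mw: "M *\<^sub>v w \<in> carrier_vec n" using M w by (rule mult_mat_vec_carrier)
  have AMw: "A *\<^sub>v (M *\<^sub>v w) \<in> carrier_vec n" using Ac Mw by (rule mult_mat_vec_carrier)
  have Tv: "?T *\<^sub>v v = v + (-1) \<cdot>\<^sub>v (M *\<^sub>v w)"
  proof -
    have "?T *\<^sub>v v = v - M *\<^sub>v w"
      using minus_mult_distrib_mat_vec[OF one_carrier_mat MA v] assoc_mult_mat_vec[OF M Ac v] Av v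
      by simp
    also have "\<dots> = v + (-1) \<cdot>\<^sub>v (M *\<^sub>v w)" using v Mw by (intro eq_vecI) auto
    finally show ?thesis .
  qed
  have "0 \<le> energy_norm A v"
    using spd_mat_nonneg[OF A v] comm_scalar_prod[OF v mult_mat_vec_carrier[OF Ac v]]
    by (simp add: energy_norm_def)
  then have "energy_norm A (?T *\<^sub>v v) \<le> 1 * energy_norm A v"
    using energy_norm_le_opnorm[OF A T v v0] mult_right_mono[OF ne] by fastforce
  then have "scalar_prod (?T *\<^sub>v v) (A *\<^sub>v (?T *\<^sub>v v)) \<le> scalar_prod v (A *\<^sub>v v)"
    using comm_scalar_prod[OF v mult_mat_vec_carrier[OF Ac v]]
      comm_scalar_prod[OF mult_mat_vec_carrier[OF T v] mult_mat_vec_carrier[OF Ac mult_mat_vec_carrier[OF T v]]]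
    by (simp add: energy_norm_def)
  then have "0 \<le> 2 * scalar_prod v (A *\<^sub>v (M *\<^sub>v w)) - scalar_prod (M *\<^sub>v w) (A *\<^sub>v (M *\<^sub>v w))"
    unfolding Tv form_add[OF As v Mw] by simp
  moreover have "scalar_prod v (A *\<^sub>v (M *\<^sub>v w)) = scalar_prod w (M *\<^sub>v w)"
    using sym_mat_swap[OF As v Mw] Av comm_scalar_prod[OF w Mw] by simp
  moreover have "scalar_prod w (transpose_mat M *\<^sub>v w) = scalar_prod w (M *\<^sub>v w)"
    using transpose_vec_mult_scalar[OF M w w] comm_scalar_prod[OF w Mw]
      comm_scalar_prod[OF w mult_mat_vec_carrier[OF Mt w]] by simp
  moreover have "scalar_prod w (sym_smoother A M *\<^sub>v w) =
      scalar_prod w (M *\<^sub>v w) + scalar_prod w (transpose_mat M *\<^sub>v w)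
      - scalar_prod (M *\<^sub>v w) (A *\<^sub>v (M *\<^sub>v w))"
  proof -
    let ?R = "transpose_mat M * A * M"
    have R: "?R \<in> carrier_mat n n" using M Ac by simp
    have c: "M *\<^sub>v w \<in> carrier_vec n" "transpose_mat M *\<^sub>v w \<in> carrier_vec n" "?R *\<^sub>v w \<in> carrier_vec n"
      using Mw mult_mat_vec_carrier[OF Mt w] mult_mat_vec_carrier[OF R w] by auto
    have "sym_smoother A M *\<^sub>v w = M *\<^sub>v w + transpose_mat M *\<^sub>v w - ?R *\<^sub>v w"
      unfolding sym_smoother_eq[OF Ac M inv] minus_mult_distrib_mat_vec[OF add_carrier_mat[OF Mt] R w]
        add_mult_distrib_mat_vec[OF M Mt w] ..
    then show ?thesis
      using scalar_prod_minus_distrib[OF w add_carrier_vec[OF c(1,2)] c(3)]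
        scalar_prod_add_distrib[OF w c(1,2)] form_sandwich[OF Ac M w] by simp
  qed
  ultimately show ?thesis by simp
qed

section \<open>One step of the cycle\<close>

text \<open>
  The factor $(I - M^T A) P$ to the left of $C$ is the transpose of the factor to its right, so the
  coarse part of the cycle is a congruence transform of $C$.
\<close>

lemma cycle_op_eq:
  assumes A: "spd_mat n A" and M: "M \<in> carrier_mat n n" and P: "P \<in> carrier_mat n m"
    and C: "C \<in> carrier_mat m m"
  defines "K \<equiv> transpose_mat P * (1\<^sub>m n - A * M)"
  shows "cycle_op A M P C = sym_smoother A M + transpose_mat K * C * K"
proof -
  have Ac: "A \<in> carrier_mat n n" and At: "transpose_mat A = A" using A by (auto simp: spd_mat_def)
  have AM: "A * M \<in> carrier_mat n n" using Ac M by (rule mult_carrier_mat)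
  let ?E = "1\<^sub>m n - A * M" and ?F = "1\<^sub>m n - transpose_mat M * A"
  have E: "?E \<in> carrier_mat n n" using AM by (rule minus_carrier_mat)
  have F: "?F \<in> carrier_mat n n"
    using Ac M by (intro minus_carrier_mat mult_carrier_mat[of _ n n]) simp_all
  have Pt: "transpose_mat P \<in> carrier_mat m n" using P by simp
  have "transpose_mat ?E = ?F"
    using transpose_minus[OF one_carrier_mat AM] transpose_mult[OF Ac M] At by simp
  then have Kt: "transpose_mat K = ?F * P"
    unfolding K_def using transpose_mult[OF Pt E] by simp
  have FPC: "?F * P * C \<in> carrier_mat n m" using F P C by (meson mult_carrier_mat)
  have "?F * P * C * transpose_mat P * ?E = transpose_mat K * C * K"
    unfolding Kt unfolding K_def by (rule assoc_mult_mat[OF FPC Pt E])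
  moreover have "dim_row A = n" using Ac by simp
  ultimately show ?thesis by (simp add: cycle_op_def)
qed

lemma sym_mat_cycle_op:
  assumes A: "spd_mat n A" and M: "M \<in> carrier_mat n n" and inv: "invertible_mat M"
    and P: "P \<in> carrier_mat n m" and C: "sym_mat m C"
  shows "sym_mat n (cycle_op A M P C)"
proof -
  have "transpose_mat P * (1\<^sub>m n - A * M) \<in> carrier_mat m n"
    using A M P by (intro mult_carrier_mat) (auto simp: spd_mat_def)
  then show ?thesis
    unfolding cycle_op_eq[OF A M P sym_mat_carrier[OF C]]
    by (intro sym_mat_add sym_mat_sym_smoother[OF A M inv] sym_mat_sandwich[OF C])
qed

lemma form_cycle_op:
  assumes A: "spd_mat n A" and M: "M \<in> carrier_mat n n" and inv: "invertible_mat M"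
    and P: "P \<in> carrier_mat n m" and C: "C \<in> carrier_mat m m" and w: "w \<in> carrier_vec n"
  defines "z \<equiv> transpose_mat P * (1\<^sub>m n - A * M) *\<^sub>v w"
  shows "scalar_prod w (cycle_op A M P C *\<^sub>v w) =
     scalar_prod w (sym_smoother A M *\<^sub>v w) + scalar_prod z (C *\<^sub>v z)"
proof -
  let ?K = "transpose_mat P * (1\<^sub>m n - A * M)"
  have K: "?K \<in> carrier_mat m n"
    using A M P by (intro mult_carrier_mat) (auto simp: spd_mat_def)
  have S: "sym_smoother A M \<in> carrier_mat n n"
    by (rule sym_mat_carrier[OF sym_mat_sym_smoother[OF A M inv]])
  have R: "transpose_mat ?K * C * ?K \<in> carrier_mat n n" using K C by (meson mult_carrier_mat transpose_carrier_mat)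
  show ?thesis
    unfolding z_def cycle_op_eq[OF A M P C] add_mult_distrib_mat_vec[OF S R w]
      scalar_prod_add_distrib[OF w mult_mat_vec_carrier[OF S w] mult_mat_vec_carrier[OF R w]]
      form_sandwich[OF C K w] ..
qed

text \<open>
  The part of the cycle that does not involve the coarse matrix is the form of $\overline M \ge 0$,
  which does not increase when multiplied by $c \le 1$. The upper bound below is the mirror image.
\<close>

lemma cycle_op_scale_lower:
  assumes A: "spd_mat n A" and M: "M \<in> carrier_mat n n" and inv: "invertible_mat M"
    and ne: "energy_opnorm A (1\<^sub>m n - M * A) \<le> 1"
    and P: "P \<in> carrier_mat n m" and C: "sym_mat m C" and D: "sym_mat m D"
    and c: "c \<le> 1" and le: "loewner_le m (c \<cdot>\<^sub>m D) C"
  shows "loewner_le n (c \<cdot>\<^sub>m cycle_op A M P D) (cycle_op A M P C)"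
  unfolding loewner_le_def
proof
  fix w :: "real vec" assume w: "w \<in> carrier_vec n"
  note Cc = sym_mat_carrier[OF C] and Dc = sym_mat_carrier[OF D]
  let ?z = "transpose_mat P * (1\<^sub>m n - A * M) *\<^sub>v w"
  have "transpose_mat P * (1\<^sub>m n - A * M) \<in> carrier_mat m n"
    using A M P by (intro mult_carrier_mat) (auto simp: spd_mat_def)
  then have z: "?z \<in> carrier_vec m" using w by (rule mult_mat_vec_carrier)
  have "c * scalar_prod ?z (D *\<^sub>v ?z) \<le> scalar_prod ?z (C *\<^sub>v ?z)"
    using le z form_smult_mat[OF Dc z] by (metis loewner_le_def)
  moreover have "c * scalar_prod w (sym_smoother A M *\<^sub>v w) \<le> scalar_prod w (sym_smoother A M *\<^sub>v w)"
    using mult_right_mono[OF c nonexpansive_smoother_psd[OF A M inv ne w]] by simp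
  ultimately show "scalar_prod w ((c \<cdot>\<^sub>m cycle_op A M P D) *\<^sub>v w) \<le> scalar_prod w (cycle_op A M P C *\<^sub>v w)"
    unfolding form_smult_mat[OF sym_mat_carrier[OF sym_mat_cycle_op[OF A M inv P D]] w]
      form_cycle_op[OF A M inv P Cc w] form_cycle_op[OF A M inv P Dc w]
    by (simp add: distrib_left)
qed

lemma cycle_op_scale_upper:
  assumes A: "spd_mat n A" and M: "M \<in> carrier_mat n n" and inv: "invertible_mat M"
    and ne: "energy_opnorm A (1\<^sub>m n - M * A) \<le> 1"
    and P: "P \<in> carrier_mat n m" and C: "sym_mat m C" and D: "sym_mat m D"
    and c: "1 \<le> c" and le: "loewner_le m C (c \<cdot>\<^sub>m D)"
  shows "loewner_le n (cycle_op A M P C) (c \<cdot>\<^sub>m cycle_op A M P D)"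
  unfolding loewner_le_def
proof
  fix w :: "real vec" assume w: "w \<in> carrier_vec n"
  note Cc = sym_mat_carrier[OF C] and Dc = sym_mat_carrier[OF D]
  let ?z = "transpose_mat P * (1\<^sub>m n - A * M) *\<^sub>v w"
  have "transpose_mat P * (1\<^sub>m n - A * M) \<in> carrier_mat m n"
    using A M P by (intro mult_carrier_mat) (auto simp: spd_mat_def)
  then have z: "?z \<in> carrier_vec m" using w by (rule mult_mat_vec_carrier)
  have "scalar_prod ?z (C *\<^sub>v ?z) \<le> c * scalar_prod ?z (D *\<^sub>v ?z)"
    using le z form_smult_mat[OF Dc z] by (metis loewner_le_def)
  moreover have "scalar_prod w (sym_smoother A M *\<^sub>v w) \<le> c * scalar_prod w (sym_smoother A M *\<^sub>v w)"
    using mult_right_mono[OF c nonexpansive_smoother_psd[OF A M inv ne w]] by simp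
  ultimately show "scalar_prod w (cycle_op A M P C *\<^sub>v w) \<le> scalar_prod w ((c \<cdot>\<^sub>m cycle_op A M P D) *\<^sub>v w)"
    unfolding form_smult_mat[OF sym_mat_carrier[OF sym_mat_cycle_op[OF A M inv P D]] w]
      form_cycle_op[OF A M inv P Cc w] form_cycle_op[OF A M inv P Dc w]
    by (simp add: distrib_left)
qed

text \<open>
  Here \<open>D\<close> stands for the exact coarse inverse, so that the two assumptions on \<open>cycle_op A M P D\<close>
  are the two-grid bounds.
\<close>

lemma cycle_op_bounds:
  assumes A: "spd_mat n A" and M: "M \<in> carrier_mat n n" and inv: "invertible_mat M"
    and ne: "energy_opnorm A (1\<^sub>m n - M * A) \<le> 1"
    and P: "P \<in> carrier_mat n m" and C: "sym_mat m C" and D: "sym_mat m D"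
    and tg_lo: "loewner_le n (d \<cdot>\<^sub>m minv A) (cycle_op A M P D)"
    and tg_up: "loewner_le n (cycle_op A M P D) (1 \<cdot>\<^sub>m minv A)"
    and c: "0 \<le> c" "c \<le> 1" and L: "1 \<le> L"
    and lo: "loewner_le m (c \<cdot>\<^sub>m D) C" and up: "loewner_le m C (L \<cdot>\<^sub>m D)"
    and \<mu>: "\<mu> \<le> d * c"
  shows "loewner_le n (\<mu> \<cdot>\<^sub>m minv A) (cycle_op A M P C)"
    and "loewner_le n (cycle_op A M P C) (L \<cdot>\<^sub>m minv A)"
proof -
  have m: "minv A \<in> carrier_mat n n" by (rule spd_minv_inverts(1)[OF A])
  have T: "cycle_op A M P D \<in> carrier_mat n n"
    by (rule sym_mat_carrier[OF sym_mat_cycle_op[OF A M inv P D]])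
  have "\<mu> * scalar_prod w (minv A *\<^sub>v w) \<le> scalar_prod w (cycle_op A M P C *\<^sub>v w)"
    if w: "w \<in> carrier_vec n" for w
  proof -
    have "\<mu> * scalar_prod w (minv A *\<^sub>v w) \<le> d * c * scalar_prod w (minv A *\<^sub>v w)"
      by (rule mult_right_mono[OF \<mu> spd_mat_nonneg[OF spd_minv[OF A] w]])
    also have "\<dots> = c * (d * scalar_prod w (minv A *\<^sub>v w))" by simp
    also have "\<dots> \<le> c * scalar_prod w (cycle_op A M P D *\<^sub>v w)"
      using tg_lo w form_smult_mat[OF m w] c(1)
      by (intro mult_left_mono) (auto simp: loewner_le_def)
    also have "\<dots> \<le> scalar_prod w (cycle_op A M P C *\<^sub>v w)"
      using cycle_op_scale_lower[OF A M inv ne P C D c(2) lo] w form_smult_mat[OF T w]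
      by (auto simp: loewner_le_def)
    finally show ?thesis .
  qed
  then show "loewner_le n (\<mu> \<cdot>\<^sub>m minv A) (cycle_op A M P C)"
    by (simp add: loewner_le_def form_smult_mat[OF m])
  have "scalar_prod w (cycle_op A M P C *\<^sub>v w) \<le> L * scalar_prod w (minv A *\<^sub>v w)"
    if w: "w \<in> carrier_vec n" for w
  proof -
    have "scalar_prod w (cycle_op A M P C *\<^sub>v w) \<le> L * scalar_prod w (cycle_op A M P D *\<^sub>v w)"
      using cycle_op_scale_upper[OF A M inv ne P C D L up] w form_smult_mat[OF T w]
      by (auto simp: loewner_le_def)
    also have "\<dots> \<le> L * scalar_prod w (minv A *\<^sub>v w)"
      using tg_up w form_smult_mat[OF m w, of 1] L
      by (intro mult_left_mono) (auto simp: loewner_le_def)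
    finally show ?thesis .
  qed
  then show "loewner_le n (cycle_op A M P C) (L \<cdot>\<^sub>m minv A)"
    by (simp add: loewner_le_def form_smult_mat[OF m])
qed

section \<open>Quadratic coarse corrections\<close>

lemma poly_mat_quadratic:
  assumes X: "X \<in> carrier_mat n n" and g: "\<gamma> \<noteq> 0"
  shows "poly_mat [:1, -\<beta>, \<gamma>:] X = 1\<^sub>m n - (\<beta> \<cdot>\<^sub>m X - \<gamma> \<cdot>\<^sub>m (X * X))"
proof (rule eq_matI)
  fix i j assume "i < dim_row (1\<^sub>m n - (\<beta> \<cdot>\<^sub>m X - \<gamma> \<cdot>\<^sub>m (X * X)))" "j < dim_col (1\<^sub>m n - (\<beta> \<cdot>\<^sub>m X - \<gamma> \<cdot>\<^sub>m (X * X)))"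
  then have ij: "i < n" "j < n" using X by auto
  have d: "degree [:1, -\<beta>, \<gamma>:] = 2" using g by simp
  have pw: "X ^\<^sub>m 0 = 1\<^sub>m n" "X ^\<^sub>m 1 = X" "X ^\<^sub>m 2 = X * X" using X by (auto simp: numeral_2_eq_2)
  have XX: "X * X \<in> carrier_mat n n" using X X by (rule mult_carrier_mat)
  have "{..2::nat} = {0, 1, 2}" by auto
  then have "poly_mat [:1, -\<beta>, \<gamma>:] X $$ (i, j) =
      (1\<^sub>m n) $$ (i, j) - \<beta> * X $$ (i, j) + \<gamma> * (X * X) $$ (i, j)"
    unfolding poly_mat_def d using ij X pw
    by (simp add: numeral_2_eq_2 del: index_mult_mat)
  then show "poly_mat [:1, -\<beta>, \<gamma>:] X $$ (i, j) = (1\<^sub>m n - (\<beta> \<cdot>\<^sub>m X - \<gamma> \<cdot>\<^sub>m (X * X))) $$ (i, j)"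
    using ij X XX by (simp del: index_mult_mat(1))
qed (use X in \<open>simp_all add: poly_mat_def\<close>)

text \<open>
  The inverse of \<open>A\<close> cancels because $1 - p$ has no constant term.
\<close>

lemma amli_correction_quadratic:
  assumes A: "spd_mat n A" and B: "B \<in> carrier_mat n n" and g: "\<gamma> \<noteq> 0"
  shows "amli_correction [:1, -\<beta>, \<gamma>:] A B = \<beta> \<cdot>\<^sub>m B - \<gamma> \<cdot>\<^sub>m (B * A * B)"
proof -
  have Ac: "A \<in> carrier_mat n n" using A by (simp add: spd_mat_def)
  let ?X = "B * A"
  have X: "?X \<in> carrier_mat n n" using B Ac by (rule mult_carrier_mat)
  have XX: "?X * ?X \<in> carrier_mat n n" using X X by (rule mult_carrier_mat)
  note m = spd_minv_inverts[OF A]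
  have Xm: "?X * minv A = B" using assoc_mult_mat[OF B Ac m(1)] m(2) B by simp
  have XXm: "?X * ?X * minv A = B * A * B" using assoc_mult_mat[OF X X m(1)] Xm by simp
  have "1\<^sub>m n - poly_mat [:1, -\<beta>, \<gamma>:] ?X = \<beta> \<cdot>\<^sub>m ?X - \<gamma> \<cdot>\<^sub>m (?X * ?X)"
    unfolding poly_mat_quadratic[OF X g]
    using X XX by (intro eq_matI) (simp_all del: index_mult_mat(1))
  then have "amli_correction [:1, -\<beta>, \<gamma>:] A B = (\<beta> \<cdot>\<^sub>m ?X - \<gamma> \<cdot>\<^sub>m (?X * ?X)) * minv A"
    using Ac by (simp add: amli_correction_def)
  also have "\<dots> = \<beta> \<cdot>\<^sub>m ?X * minv A - \<gamma> \<cdot>\<^sub>m (?X * ?X) * minv A"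
    by (rule minus_mult_distrib_mat[OF smult_carrier_mat[OF X] smult_carrier_mat[OF XX] m(1)])
  also have "\<dots> = \<beta> \<cdot>\<^sub>m B - \<gamma> \<cdot>\<^sub>m (B * A * B)"
    using mult_smult_assoc_mat[OF X m(1)] mult_smult_assoc_mat[OF XX m(1)] Xm XXm by simp
  finally show ?thesis .
qed

lemma sym_mat_amli_correction_quadratic:
  assumes A: "spd_mat n A" and B: "sym_mat n B" and g: "\<gamma> \<noteq> 0"
  shows "sym_mat n (amli_correction [:1, -\<beta>, \<gamma>:] A B)"
proof -
  have Bc: "B \<in> carrier_mat n n" "transpose_mat B = B" using B by (auto simp: sym_mat_def)
  have "sym_mat n (B * A * B)" using sym_mat_sandwich[OF spd_mat_sym[OF A] Bc(1)] Bc(2) by simp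
  then show ?thesis
    unfolding amli_correction_quadratic[OF A Bc(1) g] by (intro sym_mat_minus sym_mat_smult B)
qed

lemma form_amli_correction_quadratic:
  assumes A: "spd_mat n A" and B: "sym_mat n B" and g: "\<gamma> \<noteq> 0" and w: "w \<in> carrier_vec n"
  shows "scalar_prod w (amli_correction [:1, -\<beta>, \<gamma>:] A B *\<^sub>v w) =
     \<beta> * scalar_prod w (B *\<^sub>v w) - \<gamma> * scalar_prod (B *\<^sub>v w) (A *\<^sub>v (B *\<^sub>v w))"
proof -
  have Ac: "A \<in> carrier_mat n n" using A by (simp add: spd_mat_def)
  have Bc: "B \<in> carrier_mat n n" "transpose_mat B = B" using B by (auto simp: sym_mat_def)
  have R: "B * A * B \<in> carrier_mat n n" using Bc(1) Ac by simp
  have bB: "\<beta> \<cdot>\<^sub>m B \<in> carrier_mat n n" and gR: "\<gamma> \<cdot>\<^sub>m (B * A * B) \<in> carrier_mat n n"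
    using Bc(1) R by auto
  show ?thesis
    unfolding amli_correction_quadratic[OF A Bc(1) g] minus_mult_distrib_mat_vec[OF bB gR w]
      scalar_prod_minus_distrib[OF w mult_mat_vec_carrier[OF bB w] mult_mat_vec_carrier[OF gR w]]
      form_smult_mat[OF Bc(1) w] form_smult_mat[OF R w]
    using form_sandwich[OF Ac Bc(1) w] Bc(2) by simp
qed

lemma form_shifted_square:
  fixes \<kappa> :: real
  assumes A: "spd_mat n A" and B: "sym_mat n B" and w: "w \<in> carrier_vec n"
  defines "y \<equiv> B *\<^sub>v w + (- \<kappa>) \<cdot>\<^sub>v (minv A *\<^sub>v w)"
  shows "scalar_prod y (A *\<^sub>v y) = scalar_prod (B *\<^sub>v w) (A *\<^sub>v (B *\<^sub>v w))
     - 2 * \<kappa> * scalar_prod w (B *\<^sub>v w) + \<kappa>\<^sup>2 * scalar_prod w (minv A *\<^sub>v w)"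
proof -
  have Bw: "B *\<^sub>v w \<in> carrier_vec n" using sym_mat_carrier[OF B] w by (rule mult_mat_vec_carrier)
  have Iw: "minv A *\<^sub>v w \<in> carrier_vec n" using spd_minv_inverts(1)[OF A] w by (rule mult_mat_vec_carrier)
  show ?thesis
    unfolding y_def form_add[OF spd_mat_sym[OF A] Bw Iw] spd_minv_apply(1)[OF A w]
    using comm_scalar_prod[OF Bw w] comm_scalar_prod[OF Iw w] by simp
qed

text \<open>
  This is $x^2 \le (\mu + L) x - \mu L$ on $[\mu, L]$, transferred to $B$. For $H = B - \mu A^{-1}$,
  $0 \le H \le (L - \mu) A^{-1}$, the Cauchy-Schwarz inequality of $H$ for $w$ and $A H w$ gives
  $(w^T H A H w)^2 \le (w^T H w) (L - \mu) (w^T H A H w)$, that is $H A H \le (L - \mu) H$.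
\<close>

lemma square_le_chord:
  assumes A: "spd_mat n A" and B: "sym_mat n B"
    and lo: "loewner_le n (\<mu> \<cdot>\<^sub>m minv A) B" and up: "loewner_le n B (L \<cdot>\<^sub>m minv A)"
    and mL: "\<mu> \<le> L" and w: "w \<in> carrier_vec n"
  shows "scalar_prod (B *\<^sub>v w) (A *\<^sub>v (B *\<^sub>v w)) \<le>
     (\<mu> + L) * scalar_prod w (B *\<^sub>v w) - \<mu> * L * scalar_prod w (minv A *\<^sub>v w)"
proof -
  have Ac: "A \<in> carrier_mat n n" using A by (simp add: spd_mat_def)
  have Bc: "B \<in> carrier_mat n n" using B by (rule sym_mat_carrier)
  note m = spd_minv_inverts[OF A]
  let ?H = "B - \<mu> \<cdot>\<^sub>m minv A"
  have H: "sym_mat n ?H" by (intro sym_mat_minus sym_mat_smult B spd_mat_sym[OF spd_minv[OF A]])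
  have Hv: "?H *\<^sub>v v = B *\<^sub>v v + (- \<mu>) \<cdot>\<^sub>v (minv A *\<^sub>v v)" if v: "v \<in> carrier_vec n" for v
  proof -
    have "?H *\<^sub>v v = B *\<^sub>v v - \<mu> \<cdot>\<^sub>v (minv A *\<^sub>v v)"
      using minus_mult_distrib_mat_vec[OF Bc smult_carrier_mat[OF m(1)] v] smult_mult_mat_vec[OF m(1) v] by simp
    also have "\<dots> = B *\<^sub>v v + (- \<mu>) \<cdot>\<^sub>v (minv A *\<^sub>v v)"
      using mult_mat_vec_carrier[OF Bc v] mult_mat_vec_carrier[OF m(1) v]
      by (intro eq_vecI) auto
    finally show ?thesis .
  qed
  have Hf: "scalar_prod v (?H *\<^sub>v v) = scalar_prod v (B *\<^sub>v v) - \<mu> * scalar_prod v (minv A *\<^sub>v v)"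
    if v: "v \<in> carrier_vec n" for v
    unfolding Hv[OF v]
    using v mult_mat_vec_carrier[OF Bc v] mult_mat_vec_carrier[OF m(1) v]
    by (simp add: scalar_prod_add_distrib[of _ n])
  have psd: "0 \<le> scalar_prod v (?H *\<^sub>v v)" if v: "v \<in> carrier_vec n" for v
    using lo v Hf[OF v] form_smult_mat[OF m(1) v] by (auto simp: loewner_le_def)
  have Hup: "scalar_prod v (?H *\<^sub>v v) \<le> (L - \<mu>) * scalar_prod v (minv A *\<^sub>v v)"
    if v: "v \<in> carrier_vec n" for v
    using up v Hf[OF v] form_smult_mat[OF m(1) v] by (auto simp: loewner_le_def algebra_simps)
  \<comment> \<open>\<open>x\<close> is the vector $A H w$ for which the Cauchy-Schwarz inequality becomes one in \<open>?R\<close> alone\<close>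
  define y where "y = ?H *\<^sub>v w"
  have y: "y \<in> carrier_vec n" unfolding y_def using sym_mat_carrier[OF H] w by (rule mult_mat_vec_carrier)
  define x where "x = A *\<^sub>v y"
  have x: "x \<in> carrier_vec n" unfolding x_def using Ac y by (rule mult_mat_vec_carrier)
  let ?R = "scalar_prod y (A *\<^sub>v y)"
  have R0: "0 \<le> ?R" using spd_mat_nonneg[OF A y] .
  have "scalar_prod w (?H *\<^sub>v x) = ?R"
    using sym_mat_swap[OF H w x] comm_scalar_prod[OF x y] by (simp add: y_def x_def)
  moreover have "scalar_prod x (minv A *\<^sub>v x) = ?R"
    using spd_minv_apply(2)[OF A y] comm_scalar_prod[OF x y] by (simp add: x_def)
  ultimately have "?R\<^sup>2 \<le> scalar_prod w (?H *\<^sub>v w) * ((L - \<mu>) * ?R)"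
    using psd_cauchy_schwarz[OF H psd w x] mult_left_mono[OF Hup[OF x] psd[OF w]] by simp
  then have "?R * ?R \<le> ((L - \<mu>) * scalar_prod w (?H *\<^sub>v w)) * ?R"
    by (simp add: power2_eq_square mult.commute mult.left_commute)
  moreover have "0 \<le> (L - \<mu>) * scalar_prod w (?H *\<^sub>v w)" using psd[OF w] mL by simp
  ultimately have "?R \<le> (L - \<mu>) * scalar_prod w (?H *\<^sub>v w)"
    using R0 by (cases "?R = 0") auto
  moreover have "?R = scalar_prod (B *\<^sub>v w) (A *\<^sub>v (B *\<^sub>v w))
     - 2 * \<mu> * scalar_prod w (B *\<^sub>v w) + \<mu>\<^sup>2 * scalar_prod w (minv A *\<^sub>v w)"
    unfolding y_def Hv[OF w] by (rule form_shifted_square[OF A B w])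
  ultimately show ?thesis unfolding Hf[OF w] by (simp add: power2_eq_square algebra_simps)
qed

text \<open>
  The chord of $\beta x - \gamma x^2$ over $[\mu, L]$ has slope $\beta - \gamma (\mu + L)$. Where that is
  nonnegative, the value at $\mu$ is the smallest one.
\<close>

lemma correction_lower:
  assumes A: "spd_mat n A" and B: "sym_mat n B" and g: "0 < \<gamma>"
    and lo: "loewner_le n (\<mu> \<cdot>\<^sub>m minv A) B" and up: "loewner_le n B (L \<cdot>\<^sub>m minv A)"
    and mL: "\<mu> \<le> L" and slope: "\<gamma> * (\<mu> + L) \<le> \<beta>"
  shows "loewner_le n ((\<beta> * \<mu> - \<gamma> * \<mu>\<^sup>2) \<cdot>\<^sub>m minv A) (amli_correction [:1, -\<beta>, \<gamma>:] A B)"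
  unfolding loewner_le_def
proof
  fix w :: "real vec" assume w: "w \<in> carrier_vec n"
  have gn: "\<gamma> \<noteq> 0" using g by simp
  note m = spd_minv_inverts(1)[OF A]
  define s t r where "s = scalar_prod w (minv A *\<^sub>v w)" and "t = scalar_prod w (B *\<^sub>v w)"
    and "r = scalar_prod (B *\<^sub>v w) (A *\<^sub>v (B *\<^sub>v w))"
  have "\<mu> * s \<le> t" using lo w form_smult_mat[OF m w] by (auto simp: loewner_le_def s_def t_def)
  then have "0 \<le> (\<beta> - \<gamma> * (\<mu> + L)) * (t - \<mu> * s)" using slope by simp
  moreover have "\<gamma> * r \<le> \<gamma> * ((\<mu> + L) * t - \<mu> * L * s)"
    using square_le_chord[OF A B lo up mL w] g by (simp add: r_def s_def t_def)
  ultimately have "(\<beta> * \<mu> - \<gamma> * \<mu>\<^sup>2) * s \<le> \<beta> * t - \<gamma> * r"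
    by (simp add: power2_eq_square algebra_simps)
  then show "scalar_prod w (((\<beta> * \<mu> - \<gamma> * \<mu>\<^sup>2) \<cdot>\<^sub>m minv A) *\<^sub>v w) \<le>
      scalar_prod w (amli_correction [:1, -\<beta>, \<gamma>:] A B *\<^sub>v w)"
    unfolding form_amli_correction_quadratic[OF A B gn w] form_smult_mat[OF m w]
    by (simp add: r_def s_def t_def)
qed

text \<open>
  The linear coefficient is chosen so that
  $(e L + \gamma \kappa^2) - ((e + 2 \gamma \kappa) x - \gamma x^2) = e (L - x) + \gamma (x - \kappa)^2$.
\<close>

lemma correction_upper:
  assumes A: "spd_mat n A" and B: "sym_mat n B" and g: "0 < \<gamma>"
    and up: "loewner_le n B (L \<cdot>\<^sub>m minv A)" and e: "0 \<le> e"
  shows "loewner_le n (amli_correction [:1, -(e + 2 * \<gamma> * \<kappa>), \<gamma>:] A B) ((e * L + \<gamma> * \<kappa>\<^sup>2) \<cdot>\<^sub>m minv A)"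
  unfolding loewner_le_def
proof
  fix w :: "real vec" assume w: "w \<in> carrier_vec n"
  have gn: "\<gamma> \<noteq> 0" using g by simp
  have Bw: "B *\<^sub>v w \<in> carrier_vec n" using sym_mat_carrier[OF B] w by (rule mult_mat_vec_carrier)
  note m = spd_minv_inverts(1)[OF A]
  define s t r where "s = scalar_prod w (minv A *\<^sub>v w)" and "t = scalar_prod w (B *\<^sub>v w)"
    and "r = scalar_prod (B *\<^sub>v w) (A *\<^sub>v (B *\<^sub>v w))"
  have "t \<le> L * s" using up w form_smult_mat[OF m w] by (auto simp: loewner_le_def s_def t_def)
  then have 1: "e * t \<le> e * (L * s)" using e by (rule mult_left_mono)
  have "B *\<^sub>v w + (- \<kappa>) \<cdot>\<^sub>v (minv A *\<^sub>v w) \<in> carrier_vec n"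
    using Bw mult_mat_vec_carrier[OF m w] by simp
  from spd_mat_nonneg[OF A this] have "0 \<le> r - 2 * \<kappa> * t + \<kappa>\<^sup>2 * s"
    unfolding form_shifted_square[OF A B w] by (simp add: r_def s_def t_def)
  then have "0 \<le> \<gamma> * (r - 2 * \<kappa> * t + \<kappa>\<^sup>2 * s)" using g by simp
  with 1 have "(e + 2 * \<gamma> * \<kappa>) * t - \<gamma> * r \<le> (e * L + \<gamma> * \<kappa>\<^sup>2) * s"
    by (simp add: algebra_simps)
  then show "scalar_prod w (amli_correction [:1, -(e + 2 * \<gamma> * \<kappa>), \<gamma>:] A B *\<^sub>v w) \<le>
      scalar_prod w (((e * L + \<gamma> * \<kappa>\<^sup>2) \<cdot>\<^sub>m minv A) *\<^sub>v w)"
    unfolding form_amli_correction_quadratic[OF A B gn w] form_smult_mat[OF m w]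
    by (simp add: r_def s_def t_def)
qed

section \<open>Bounds on all levels\<close>

text \<open>
  The spectral property of a polynomial on which the induction over the levels rests:
  if $BA$ has its spectrum in $[\mu, L]$, then $\widehat B A$ has its spectrum in $[c, L]$.
\<close>

definition correction_maps_bounds :: "real poly \<Rightarrow> real \<Rightarrow> real \<Rightarrow> real \<Rightarrow> bool" where
  "correction_maps_bounds p \<mu> L c \<longleftrightarrow>
     (\<forall>n A B. spd_mat n A \<longrightarrow> sym_mat n B \<longrightarrow>
        loewner_le n (\<mu> \<cdot>\<^sub>m minv A) B \<longrightarrow> loewner_le n B (L \<cdot>\<^sub>m minv A) \<longrightarrow>
        sym_mat n (amli_correction p A B) \<and>
        loewner_le n (c \<cdot>\<^sub>m minv A) (amli_correction p A B) \<and>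
        loewner_le n (amli_correction p A B) (L \<cdot>\<^sub>m minv A))"

text \<open>
  Downward induction on the level. The coarsest level is exact, and $A_J^{-1}$ satisfies the bounds for
  $B_J$ and those for $\widehat B_J$ because $\mu, c \le 1 \le L$.
\<close>

theorem amli_op_bounds:
  fixes J :: nat and n :: "nat \<Rightarrow> nat" and A M P :: "nat \<Rightarrow> real mat"
  assumes n: "\<And>l. l \<in> {1..J} \<Longrightarrow> n l > 0"
    and A: "\<And>l. l \<in> {1..J} \<Longrightarrow> spd_mat (n l) (A l)"
    and P: "\<And>l. l \<in> {1..<J} \<Longrightarrow> P l \<in> carrier_mat (n l) (n (Suc l))"
    and M: "\<And>l. l \<in> {1..<J} \<Longrightarrow> M l \<in> carrier_mat (n l) (n l) \<and> invertible_mat (M l)"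
    and ne: "\<And>l. l \<in> {1..<J} \<Longrightarrow> energy_opnorm (A l) (1\<^sub>m (n l) - M l * A l) \<le> 1"
    and tg: "two_grid_converges J A M P \<delta>"
    and p: "correction_maps_bounds p \<mu> L c" and c: "0 \<le> c" "c \<le> 1" and L: "1 \<le> L"
    and \<mu>: "\<mu> \<le> 1" "\<mu> \<le> (1 - \<delta>) * c"
    and l: "1 \<le> l" "l \<le> J"
  shows "sym_mat (n l) (amli_op p J A M P l)
    \<and> loewner_le (n l) (\<mu> \<cdot>\<^sub>m minv (A l)) (amli_op p J A M P l)
    \<and> loewner_le (n l) (amli_op p J A M P l) (L \<cdot>\<^sub>m minv (A l))" (is "?Q l")
  using l(2,1)
proof (induction l rule: inc_induct)
  case base
  have AJ: "spd_mat (n J) (A J)" using A base by simp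
  note mJ = spd_minv[OF AJ]
  have "amli_op p J A M P J = minv (A J)" by (simp add: amli_op.simps)
  then show ?case
    using loewner_le_refl_smult[OF mJ] \<mu>(1) L spd_mat_sym[OF mJ] by simp
next
  case (step l)
  then have l: "l \<in> {1..<J}" "l \<in> {1..J}" "Suc l \<in> {1..J}" by auto
  let ?C = "amli_op_hat p J A M P (Suc l)" and ?D = "minv (A (Suc l))"
  note Al = A[OF l(2)] and As = A[OF l(3)]
  have D: "sym_mat (n (Suc l)) ?D" by (rule spd_mat_sym[OF spd_minv[OF As]])
  have IH: "?Q (Suc l)" using step by simp
  have "sym_mat (n (Suc l)) ?C \<and> loewner_le (n (Suc l)) (c \<cdot>\<^sub>m ?D) ?C
      \<and> loewner_le (n (Suc l)) ?C (L \<cdot>\<^sub>m ?D)"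
  proof (cases "Suc l = J")
    case True
    then have "?C = ?D" by (simp add: amli_op_hat.simps)
    then show ?thesis
      using loewner_le_refl_smult[OF spd_minv[OF As]] c(2) L D by simp
  next
    case False
    then have "?C = amli_correction p (A (Suc l)) (amli_op p J A M P (Suc l))"
      using l by (simp add: amli_op_hat.simps)
    then show ?thesis using p As IH unfolding correction_maps_bounds_def by metis
  qed
  then have C: "sym_mat (n (Suc l)) ?C" and lo: "loewner_le (n (Suc l)) (c \<cdot>\<^sub>m ?D) ?C"
    and up: "loewner_le (n (Suc l)) ?C (L \<cdot>\<^sub>m ?D)" by auto
  have Ml: "M l \<in> carrier_mat (n l) (n l)" "invertible_mat (M l)" using M[OF l(1)] by auto
  have T: "sym_mat (n l) (cycle_op (A l) (M l) (P l) ?D)"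
    by (rule sym_mat_cycle_op[OF Al Ml P[OF l(1)] D])
  have "1 - \<delta> \<le> lambda_min (cycle_op (A l) (M l) (P l) ?D * A l)"
    "lambda_max (cycle_op (A l) (M l) (P l) ?D * A l) \<le> 1"
    using tg l(1) by (auto simp: two_grid_converges_def two_grid_op_def)
  then have tg_lo: "loewner_le (n l) ((1 - \<delta>) \<cdot>\<^sub>m minv (A l)) (cycle_op (A l) (M l) (P l) ?D)"
    and tg_up: "loewner_le (n l) (cycle_op (A l) (M l) (P l) ?D) (1 \<cdot>\<^sub>m minv (A l))"
    using loewner_ge_of_lambda_min[OF n[OF l(2)] Al T] loewner_le_of_lambda_max[OF n[OF l(2)] Al T] by auto
  have "amli_op p J A M P l = cycle_op (A l) (M l) (P l) ?C"
    using l(1) by (simp add: amli_op.simps)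
  then show ?case
    using cycle_op_bounds[OF Al Ml ne[OF l(1)] P[OF l(1)] C D tg_lo tg_up c L lo up \<mu>(2)]
      sym_mat_cycle_op[OF Al Ml P[OF l(1)] C] by simp
qed

section \<open>The momentum-accelerated polynomial of degree two\<close>

lemma ma_L_ge_1:
  assumes "0 < a" "a < 2"
  shows "1 \<le> ma_L a"
proof (cases "a < 2 / 3")
  case False
  have "0 \<le> (2 - a)\<^sup>2" by simp
  then have "8 * a \<le> (2 + a)\<^sup>2" by (simp add: power2_eq_square algebra_simps)
  then show ?thesis using False assms by (simp add: ma_L_def)
qed (simp add: ma_L_def)

lemma ma_poly2_scaled_eq:
  "ma_poly2_scaled a = [:1, - ((a + 2) / ma_L a), 2 * a / (ma_L a)\<^sup>2:]"
  unfolding ma_poly2_scaled_def ma_poly_2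
  by (simp add: pcompose_pCons power2_eq_square algebra_simps add_divide_distrib diff_divide_distrib)

text \<open>
  For $y = \mu / L$ the slope condition $2 a y \le 2 - a$ says that the chord of $1 - p_2$ over
  $[\mu, L]$ does not decrease. The upper bound $L$ is the maximum of $1 - p_2$ on $[0, L]$, and the two
  cases of \<open>ma_L\<close> differ in where it is attained: at the endpoint $L$ or at the vertex.
\<close>

lemma ma_correction_maps_bounds:
  assumes a: "0 < a" "a < 2" and \<mu>: "\<mu> \<le> ma_L a" and slope: "2 * a * (\<mu> / ma_L a) \<le> 2 - a"
  shows "correction_maps_bounds (ma_poly2_scaled a) \<mu> (ma_L a) (1 - poly (ma_poly2_scaled a) \<mu>)"
proof -
  define L where "L = ma_L a"
  define \<beta> \<gamma> where "\<beta> = (a + 2) / L" and "\<gamma> = 2 * a / L\<^sup>2"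
  have L: "L > 0" using ma_L_ge_1[OF a] by (simp add: L_def)
  then have g: "0 < \<gamma>" using a by (simp add: \<gamma>_def)
  then have gn: "\<gamma> \<noteq> 0" by simp
  have p: "ma_poly2_scaled a = [:1, - \<beta>, \<gamma>:]"
    unfolding ma_poly2_scaled_eq \<beta>_def \<gamma>_def L_def ..
  have c: "1 - poly (ma_poly2_scaled a) \<mu> = \<beta> * \<mu> - \<gamma> * \<mu>\<^sup>2"
    unfolding p by (simp add: power2_eq_square algebra_simps)
  have sl: "\<gamma> * (\<mu> + L) \<le> \<beta>"
  proof -
    have "\<gamma> * (\<mu> + L) = (2 * a * (\<mu> / L) + 2 * a) / L"
      using L by (simp add: \<gamma>_def field_simps power2_eq_square)
    also have "\<dots> \<le> (a + 2) / L" using slope L by (intro divide_right_mono) (auto simp: L_def)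
    finally show ?thesis by (simp add: \<beta>_def)
  qed
  obtain e \<kappa> where e: "0 \<le> e" "\<beta> = e + 2 * \<gamma> * \<kappa>" "L = e * L + \<gamma> * \<kappa>\<^sup>2"
  proof (cases "a < 2 / 3")
    case True
    then have La: "L = 2 - a" by (simp add: L_def ma_L_def)
    have "\<beta> = (2 - 3 * a) / L + 2 * \<gamma> * L"
      using L by (simp add: \<beta>_def \<gamma>_def field_simps power2_eq_square)
    moreover have "L = (2 - 3 * a) / L * L + \<gamma> * L\<^sup>2"
      using L by (simp add: \<gamma>_def La)
    \<comment> \<open>with $t = x / L$: $L - (1 - p_2(x)) = (2 - 3a)(1 - t) + 2a(1 - t)^2$\<close>
    ultimately show thesis using that[of "(2 - 3 * a) / L" L] True L by simp
  next
    case False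
    then have La: "L = (2 + a)\<^sup>2 / (8 * a)" by (simp add: L_def ma_L_def)
    \<comment> \<open>the vertex of $1 - p_2$ lies in $[0, L]$, and completing the square leaves no linear part\<close>
    have "\<beta> = 0 + 2 * \<gamma> * ((2 + a) * L / (4 * a))"
      using L a by (simp add: \<beta>_def \<gamma>_def field_simps power2_eq_square)
    moreover have "\<gamma> * ((2 + a) * L / (4 * a))\<^sup>2 = (2 + a)\<^sup>2 / (8 * a)"
      using L a by (simp add: \<gamma>_def power_mult_distrib power_divide) (simp add: power2_eq_square)
    ultimately show thesis using that[of 0 "(2 + a) * L / (4 * a)"] La by simp
  qed
  show ?thesis
    unfolding correction_maps_bounds_def c L_def[symmetric]
  proof (intro allI impI conjI)
    fix n A B assume A: "spd_mat n A" and B: "sym_mat n B"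
      and lo: "loewner_le n (\<mu> \<cdot>\<^sub>m minv A) B" and up: "loewner_le n B (L \<cdot>\<^sub>m minv A)"
    show "sym_mat n (amli_correction (ma_poly2_scaled a) A B)"
      unfolding p by (rule sym_mat_amli_correction_quadratic[OF A B gn])
    show "loewner_le n ((\<beta> * \<mu> - \<gamma> * \<mu>\<^sup>2) \<cdot>\<^sub>m minv A) (amli_correction (ma_poly2_scaled a) A B)"
      unfolding p using correction_lower[OF A B g lo up _ sl] \<mu> by (simp add: L_def)
    show "loewner_le n (amli_correction (ma_poly2_scaled a) A B) (L \<cdot>\<^sub>m minv A)"
      using correction_upper[OF A B g up e(1), of \<kappa>] unfolding p e(2)[symmetric] e(3)[symmetric] .
  qed
qed

lemma ex_admissible_mu:
  assumes a: "0 < a" "a < 2" and \<nu>: "0 < \<nu>" and \<delta>: "\<delta> < 1"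
    and small: "\<delta> < (if a < 2 / 3 then 1 - (2 - a) / (2 + a) else 1 - (2 + a) / (8 * a))"
  shows "\<exists>\<mu>. admissible_mu a \<nu> \<delta> \<mu>"
proof -
  define L where "L = ma_L a"
  have L: "L > 0" using ma_L_ge_1[OF a] by (simp add: L_def)
  have "L / (a + 2) = (if a < 2 / 3 then (2 - a) / (2 + a) else (2 + a) / (8 * a))"
    using a by (simp add: L_def ma_L_def power2_eq_square add.commute)
  then have "L / (a + 2) < 1 - \<delta>" using small by (simp split: if_splits)
  then have gap: "0 < (1 - \<delta>) * (a + 2) - L" using a by (simp add: pos_divide_less_eq)
  \<comment> \<open>\<open>\<epsilon>\<close> solves $\mu = (1 - \delta)(1 - p_2(\mu))$ for $\mu \neq 0$\<close>
  define \<epsilon> where "\<epsilon> = ((1 - \<delta>) * (a + 2) - L) * L / ((1 - \<delta>) * (2 * a))"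
  have \<epsilon>: "\<epsilon> > 0" unfolding \<epsilon>_def using gap L \<delta> a by simp
  define \<mu> where "\<mu> = min \<epsilon> (min (L * \<nu>) (1 - \<delta>))"
  have \<mu>: "0 < \<mu>" using \<epsilon> L \<nu> \<delta> by (simp add: \<mu>_def)
  have "\<mu> \<le> \<epsilon>" by (simp add: \<mu>_def)
  then have "(1 - \<delta>) * (2 * a) * \<mu> \<le> ((1 - \<delta>) * (a + 2) - L) * L"
    unfolding \<epsilon>_def using \<delta> a by (simp add: pos_le_divide_eq mult.commute)
  then have "L * L \<le> (1 - \<delta>) * ((a + 2) * L - 2 * a * \<mu>)" by (simp add: algebra_simps)
  then have "1 \<le> (1 - \<delta>) * ((a + 2) * L - 2 * a * \<mu>) / (L * L)" using L by simp
  then have "\<mu> * 1 \<le> \<mu> * ((1 - \<delta>) * ((a + 2) * L - 2 * a * \<mu>) / (L * L))"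
    using \<mu> by (intro mult_left_mono) auto
  also have "\<dots> = (1 - \<delta>) * (1 - poly (ma_poly2_scaled a) \<mu>)"
    unfolding ma_poly2_scaled_eq L_def[symmetric] using L by (simp add: field_simps power2_eq_square)
  finally have "\<mu> \<le> (1 - \<delta>) * (1 - poly (ma_poly2_scaled a) \<mu>)" by simp
  moreover have "\<mu> \<le> min (L * \<nu>) (1 - \<delta>)" unfolding \<mu>_def by (rule min.cobounded2)
  ultimately show ?thesis
    using \<mu> by (intro exI[of _ \<mu>]) (simp add: admissible_mu_def L_def)
qed

theorem corollary2:
  fixes J :: nat and n :: "nat \<Rightarrow> nat"
    and A M P :: "nat \<Rightarrow> real mat"
    and \<delta> a \<nu> :: real
  assumes "J \<ge> 2"
    and "\<And>l. l \<in> {1..J} \<Longrightarrow> n l > 0"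
    and "\<And>l. l \<in> {1..J} \<Longrightarrow> spd_mat (n l) (A l)"
    and "\<And>l. l \<in> {1..<J} \<Longrightarrow> P l \<in> carrier_mat (n l) (n (Suc l))"
    and "\<And>l. l \<in> {1..<J} \<Longrightarrow> A (Suc l) = transpose_mat (P l) * A l * P l"
    and "\<And>l. l \<in> {1..<J} \<Longrightarrow> M l \<in> carrier_mat (n l) (n l) \<and> invertible_mat (M l)"
    and "\<And>l. l \<in> {1..<J} \<Longrightarrow> energy_opnorm (A l) (1\<^sub>m (n l) - M l * A l) \<le> 1"
    and "two_grid_converges J A M P \<delta>"
    and "0 < a" and "a < 2"
    and "0 < \<nu>" and "\<nu> < 1"
    and "poly (ma_poly a 2) \<nu> \<ge> 0"
    and "antimono_on {0<..\<nu>} (poly (ma_poly a 2))"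
    and "\<And>x. x \<in> {\<nu>..1} \<Longrightarrow> poly (ma_poly a 2) x \<le> poly (ma_poly a 2) \<nu>"
  shows "(\<forall>\<mu>. admissible_mu a \<nu> \<delta> \<mu> \<longrightarrow>
            (\<forall>l \<in> {1..J}. kappa_le (amli_op (ma_poly2_scaled a) J A M P l * A l) (ma_L a / \<mu>)))
       \<and> (\<delta> < (if a < 2 / 3 then 1 - (2 - a) / (2 + a) else 1 - (2 + a) / (8 * a)) \<longrightarrow>
            (\<exists>\<mu>. admissible_mu a \<nu> \<delta> \<mu>))"
proof (intro conjI allI impI ballI)
  have \<delta>: "0 \<le> \<delta>" "\<delta> < 1" using assms(8) by (auto simp: two_grid_converges_def)
  show "\<exists>\<mu>. admissible_mu a \<nu> \<delta> \<mu>"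
    if "\<delta> < (if a < 2 / 3 then 1 - (2 - a) / (2 + a) else 1 - (2 + a) / (8 * a))"
    by (rule ex_admissible_mu[OF assms(9,10,11) \<delta>(2) that])
  fix \<mu> l assume adm: "admissible_mu a \<nu> \<delta> \<mu>" and l: "l \<in> {1..J}"
  let ?q = "poly (ma_poly a 2)"
  define y where "y = \<mu> / ma_L a"
  define c where "c = 1 - poly (ma_poly2_scaled a) \<mu>"
  have L1: "1 \<le> ma_L a" by (rule ma_L_ge_1[OF assms(9,10)])
  have \<mu>: "0 < \<mu>" "\<mu> \<le> ma_L a * \<nu>" "\<mu> \<le> 1 - \<delta>" "\<mu> \<le> (1 - \<delta>) * c"
    using adm by (auto simp: admissible_mu_def c_def)
  have y: "0 < y" "y \<le> \<nu>" using \<mu>(1,2) L1 by (auto simp: y_def pos_divide_le_eq mult.commute)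
  have q: "?q \<nu> \<le> ?q y"
    using monotone_onD[OF assms(14), of y \<nu>] y assms(11) by auto
  have "0 < (1 - \<delta>) * c" using \<mu>(1,4) by linarith
  then have c: "0 \<le> c" "c \<le> 1"
    using \<delta>(2) q assms(13) by (auto simp: zero_less_mult_iff c_def poly_ma_poly2_scaled y_def)
  have "?q 1 \<le> ?q y" using assms(15)[of 1] q assms(12) by simp
  \<comment> \<open>the difference of the two values factors, with the chord slope as one factor\<close>
  then have "0 \<le> (1 - y) * (2 - a - 2 * a * y)" by (simp add: poly_ma_poly_2 algebra_simps)
  then have slope: "2 * a * y \<le> 2 - a" using y assms(12) by (simp add: zero_le_mult_iff)
  have "ma_L a * \<nu> \<le> ma_L a * 1" using assms(12) L1 by (intro mult_left_mono) auto
  then have "\<mu> \<le> ma_L a" using \<mu>(2) by simp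
  then have "correction_maps_bounds (ma_poly2_scaled a) \<mu> (ma_L a) c"
    unfolding c_def using slope by (intro ma_correction_maps_bounds assms(9,10)) (auto simp: y_def)
  note B = amli_op_bounds[OF assms(2-4,6-8) this c L1 _ \<mu>(4)]
  show "kappa_le (amli_op (ma_poly2_scaled a) J A M P l * A l) (ma_L a / \<mu>)"
    using B[of l] l \<mu>(3) \<delta>(1) by (intro kappa_le_of_bounds[OF assms(2,3)[OF l] _ \<mu>(1)]) auto
qed

end
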